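(* Let $S_1\colon H_1\to\mathcal{G}_1$ be a compact linear operator between real Hilbert spaces, let $\lambda=(\lambda_m)_{m\in\mathbb{N}}$ be the non-increasing sequence of eigenvalues of $S_1^\dagger S_1$ (extended by zeros), and assume $\lambda_2>0$. Let $(s_d)_{d\in\mathbb{N}}$ be a sequence of positive reals and let $S_{(s)}=(S_{d,s_d}\colon\mathcal{F}_d\to\mathcal{G}_d)_{d\in\mathbb{N}}$ be the associated scaled tensor product problem. Consider the worst case setting with respect to the normalized error criterion. (1) If $\lambda_1=\lambda_2$, then $S_{(s)}$ suffers from the curse of dimensionality. (2) If $\lambda_1>\lambda_2$, then $S_{(s)}$ is not polynomially tractable. Moreover, in this case $S_{(s)}$ is weakly tractable if and only if $\lambda_n\in o((\ln n)^{-2})$, as $n\to\infty$.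
   Context: Tensor product problem: for $d\in\mathbb{N}$ let $H_d=H_1\otimes\cdots\otimes H_1$ and $\mathcal{G}_d=\mathcal{G}_1\otimes\cdots\otimes\mathcal{G}_1$ be the $d$-fold Hilbert space tensor products and $S_d=S_1\otimes\cdots\otimes S_1\colon H_d\to\mathcal{G}_d$. Scaled problem: $\mathcal{F}_d$ is the vector space $H_d$ equipped with the inner product $\langle\cdot,\cdot\rangle_{\mathcal{F}_d}=\frac1{s_d}\langle\cdot,\cdot\rangle_{H_d}$, and $S_{d,s_d}\colon\mathcal{F}_d\to\mathcal{G}_d$ is $S_d$ regarded as an operator on $\mathcal{F}_d$. Eigenvalues are counted with multiplicity; if only finitely many are positive, $\lambda$ is extended by zeros. Worst case setting: $e(n,d)=\inf_A\sup_{\|f\mid\mathcal{F}_d\|\le1}\|S_{d,s_d}f-Af\mid\mathcal{G}_d\|$, the infimum over linear algorithms $Af=\sum_{j=1}^nL_j(f)g_j$ with continuous linear functionals $L_j$ on $\mathcal{F}_d$ and $g_j\in\mathcal{G}_d$ ($A=0$ if $n=0$); $\varepsilon_d^{\mathrm{init}}=e(0,d)$. The information complexity for the normalized error criterion is $n(\varepsilon,d)=\min\{n\in\mathbb{N}_0\mid e(n,d)\le\varepsilon\cdot\varepsilon_d^{\mathrm{init}}\}$. Polynomial tractability: there are $C,p>0$, $q\ge0$ with $n(\varepsilon,d)\le C\varepsilon^{-p}d^q$ for all $\varepsilon\in(0,1]$, $d\in\mathbb{N}$. Curse of dimensionality: there are $\varepsilon>0$ and $C,\gamma>0$ with $n(\varepsilon,d)\ge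 C(1+\gamma)^d$ for infinitely many $d$. Weak tractability: $\ln n(\varepsilon_k,d_k)/(\varepsilon_k^{-1}+d_k)\to0$ for every sequence $((\varepsilon_k,d_k))_k\subset(0,1)\times\mathbb{N}$ with $\varepsilon_k^{-1}+d_k\to\infty$. *)

theory Defs
  imports "HOL-Analysis.Analysis" "HOL-Library.Landau_Symbols"
begin

text \<open>Real Hilbert spaces are types of sort \<open>{real_inner, complete_space}\<close>. Spaces that vary
  with \<open>d\<close> are closed subspaces of one ambient Hilbert space; any sequence of Hilbert
  spaces arises in this way, e.g. inside its Hilbert direct sum.\<close>

definition compact_operator :: "('a::real_normed_vector \<Rightarrow> 'b::real_normed_vector) \<Rightarrow> bool" where
  "compact_operator T \<longleftrightarrow> linear T \<and> (\<forall>B. bounded B \<longrightarrow> compact (closure (T ` B)))"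

text \<open>\<open>lam 1 \<ge> lam 2 \<ge> \<dots>\<close> are the positive eigenvalues of \<open>T\<close>, counted with multiplicity and
  extended by zeros (\<open>lam 0\<close> is irrelevant). It is meant for positive compact \<open>T\<close>, whose
  eigenspaces for \<open>\<mu> > 0\<close> are finite dimensional, so that \<open>dim\<close> is the true dimension.
  The finiteness clause is needed because \<open>card\<close> of an infinite set is \<open>0\<close>.\<close>

definition eigenvalue_sequence :: "('a::real_vector \<Rightarrow> 'a) \<Rightarrow> (nat \<Rightarrow> real) \<Rightarrow> bool" where
  "eigenvalue_sequence T lam \<longleftrightarrow>
     (\<forall>m\<ge>1. 0 \<le> lam m \<and> lam (Suc m) \<le> lam m) \<and>
     (\<forall>\<mu>>0. finite {m. 1 \<le> m \<and> lam m = \<mu>} \<and>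
            card {m. 1 \<le> m \<and> lam m = \<mu>} = dim {x. T x = \<mu> *\<^sub>R x})"

text \<open>\<open>H\<close> is the \<open>d\<close>-fold Hilbert space tensor product of \<open>'a\<close>, i.e. the completion of the
  algebraic tensor product under the inner product that is multiplicative on elementary
  tensors; \<open>t x\<close> is \<open>x 0 \<otimes> \<dots> \<otimes> x (d - 1)\<close>. These conditions determine the pair \<open>(H, t)\<close>
  up to a unique isometric isomorphism.\<close>

definition hilbert_tensor_power ::
  "nat \<Rightarrow> ((nat \<Rightarrow> 'a::{real_inner, complete_space}) \<Rightarrow> 'h::{real_inner, complete_space})
     \<Rightarrow> 'h set \<Rightarrow> bool" where
  "hilbert_tensor_power d t H \<longleftrightarrow>
     (\<forall>x y. (\<forall>i<d. x i = y i) \<longrightarrow> t x = t y) \<and>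
     (\<forall>x. \<forall>i<d. linear (\<lambda>v. t (x(i := v)))) \<and>
     (\<forall>x y. t x \<bullet> t y = (\<Prod>i<d. x i \<bullet> y i)) \<and>
     H = closure (span (range t))"

definition ip_norm :: "('h \<Rightarrow> 'h \<Rightarrow> real) \<Rightarrow> 'h \<Rightarrow> real" where
  "ip_norm ip x = sqrt (ip x x)"

text \<open>Boundedness is with respect to an explicit norm \<open>N\<close> on the subspace \<open>V\<close>.\<close>

definition bounded_linear_on ::
  "'h::real_vector set \<Rightarrow> ('h \<Rightarrow> real) \<Rightarrow> ('h \<Rightarrow> 'g::real_normed_vector) \<Rightarrow> bool" where
  "bounded_linear_on V N T \<longleftrightarrow>
     (\<forall>x\<in>V. \<forall>y\<in>V. T (x + y) = T x + T y) \<and>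
     (\<forall>c. \<forall>x\<in>V. T (c *\<^sub>R x) = c *\<^sub>R T x) \<and>
     (\<exists>K. \<forall>x\<in>V. norm (T x) \<le> K * N x)"

text \<open>On \<open>H\<close>, \<open>T\<close> is \<open>S1 \<otimes> \<dots> \<otimes> S1\<close>: the unique bounded linear operator acting factorwise on
  elementary tensors.\<close>

definition tensor_power_operator ::
  "((nat \<Rightarrow> 'a) \<Rightarrow> 'h::real_normed_vector) \<Rightarrow> 'h set \<Rightarrow>
   ((nat \<Rightarrow> 'b) \<Rightarrow> 'g::real_normed_vector) \<Rightarrow> ('a \<Rightarrow> 'b) \<Rightarrow> ('h \<Rightarrow> 'g) \<Rightarrow> bool" where
  "tensor_power_operator tH H tG S1 T \<longleftrightarrow>
     bounded_linear_on H norm T \<and> (\<forall>x. T (tH x) = tG (\<lambda>i. S1 (x i)))"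

definition scaled_inner :: "real \<Rightarrow> 'h::real_inner \<Rightarrow> 'h \<Rightarrow> real" where
  "scaled_inner c x y = 1 / c * (x \<bullet> y)"

definition linear_algorithms ::
  "'h::real_vector set \<Rightarrow> ('h \<Rightarrow> 'h \<Rightarrow> real) \<Rightarrow> 'g::real_normed_vector set \<Rightarrow> nat \<Rightarrow> ('h \<Rightarrow> 'g) set"
where
  "linear_algorithms V ip W n =
     {A. \<exists>(L :: nat \<Rightarrow> 'h \<Rightarrow> real) (g :: nat \<Rightarrow> 'g).
           (\<forall>j<n. bounded_linear_on V (ip_norm ip) (L j) \<and> g j \<in> W) \<and>
           A = (\<lambda>f. \<Sum>j<n. L j f *\<^sub>R g j)}"

text \<open>Source space: \<open>V\<close> with inner product \<open>ip\<close>; target space: \<open>W\<close>. For bounded \<open>T\<close> the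
  suprema are over nonempty bounded sets and the infimum is over a set of nonnegative reals.\<close>

definition worst_case_error ::
  "'h::real_vector set \<Rightarrow> ('h \<Rightarrow> 'h \<Rightarrow> real) \<Rightarrow> 'g::real_normed_vector set \<Rightarrow> ('h \<Rightarrow> 'g) \<Rightarrow> nat \<Rightarrow> real"
where
  "worst_case_error V ip W T n =
     (INF A \<in> linear_algorithms V ip W n.
        SUP f \<in> {f \<in> V. ip_norm ip f \<le> 1}. norm (T f - A f))"

text \<open>For compact problem operators and \<open>\<epsilon> > 0\<close> the set of admissible \<open>n\<close> is nonempty.\<close>

definition normalized_complexity :: "(nat \<Rightarrow> nat \<Rightarrow> real) \<Rightarrow> real \<Rightarrow> nat \<Rightarrow> nat" where
  "normalized_complexity e \<epsilon> d = (LEAST n. e n d \<le> \<epsilon> * e 0 d)"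

definition scaled_tensor_complexity ::
  "(nat \<Rightarrow> real) \<Rightarrow> (nat \<Rightarrow> 'h::real_inner set) \<Rightarrow> (nat \<Rightarrow> 'g::real_inner set) \<Rightarrow>
   (nat \<Rightarrow> 'h \<Rightarrow> 'g) \<Rightarrow> real \<Rightarrow> nat \<Rightarrow> nat" where
  "scaled_tensor_complexity s H G S =
     normalized_complexity (\<lambda>n d. worst_case_error (H d) (scaled_inner (s d)) (G d) (S d) n)"

definition polynomially_tractable :: "(real \<Rightarrow> nat \<Rightarrow> nat) \<Rightarrow> bool" where
  "polynomially_tractable N \<longleftrightarrow>
     (\<exists>C>0. \<exists>p>0. \<exists>q\<ge>0. \<forall>\<epsilon> d. 0 < \<epsilon> \<and> \<epsilon> \<le> 1 \<and> 1 \<le> d \<longrightarrow>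
        real (N \<epsilon> d) \<le> C * \<epsilon> powr (- p) * real d powr q)"

definition curse_of_dimensionality :: "(real \<Rightarrow> nat \<Rightarrow> nat) \<Rightarrow> bool" where
  "curse_of_dimensionality N \<longleftrightarrow>
     (\<exists>\<epsilon>>0. \<exists>C>0. \<exists>\<gamma>>0. infinite {d. 1 \<le> d \<and> real (N \<epsilon> d) \<ge> C * (1 + \<gamma>) ^ d})"

definition weakly_tractable :: "(real \<Rightarrow> nat \<Rightarrow> nat) \<Rightarrow> bool" where
  "weakly_tractable N \<longleftrightarrow>
     (\<forall>(\<epsilon> :: nat \<Rightarrow> real) (d :: nat \<Rightarrow> nat).
        (\<forall>k. 0 < \<epsilon> k \<and> \<epsilon> k < 1 \<and> 1 \<le> d k) \<and>
        filterlim (\<lambda>k. inverse (\<epsilon> k) + real (d k)) at_top sequentially \<longrightarrow>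
        (\<lambda>k. ln (real (N (\<epsilon> k) (d k))) / (inverse (\<epsilon> k) + real (d k))) \<longlonglongrightarrow> 0)"

end

theory Submission
  imports Defs "HOL-Real_Asymp.Real_Asymp"
begin

text \<open>A singular value expansion of \<open>S\<^sub>1\<close> turns the elementary tensors of singular vectors into
  an orthonormal family on which \<open>S\<^sub>d\<^sup>\<dagger> S\<^sub>d\<close> is diagonal, with the \<open>d\<close>-fold products of the
  \<open>\<lambda>\<^sub>m\<close> as eigenvalues. Hence \<open>n(\<epsilon>, d)\<close> is exactly the number of index tuples with
  \<open>\<lambda>\<^bsub>i\<^sub>1\<^esub> \<cdots> \<lambda>\<^bsub>i\<^sub>d\<^esub> > \<epsilon>\<^sup>2 \<lambda>\<^sub>1\<^sup>d\<close>; the scaling \<open>s\<^sub>d\<close> cancels. After normalising \<open>\<lambda>\<^sub>1 = 1\<close>, tuples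
  over \<open>{1, 2}\<close> give the two lower bounds and \<open>d = 1\<close> gives the necessity of the decay condition.
  For its sufficiency, at most one entry of a tuple has \<open>\<lambda> \<le> \<epsilon>\<close>. That entry has only
  \<open>exp(o(1/\<epsilon>))\<close> possible values, while the other entries range over a set of size
  \<open>exp(o(\<epsilon>\<^sup>-\<^sup>1\<^sup>/\<^sup>2))\<close>, so a power moment estimate bounds their number by \<open>exp(\<delta> d + o(1/\<epsilon>))\<close>.\<close>

section \<open>Compact operators on Hilbert spaces\<close>

text \<open>The exponents in the last step come from the decay condition: it says that the number of
  eigenvalues above x is exp(o(x^(-1/2))), and this is used at x = \<epsilon> and at x =
  \<epsilon>^2. The obstacle is a logarithm. A moment of order t counts tuples over M indices at the
  cost of a factor \<epsilon>^(-2t), and t must be of size ln M to make M a_2^t small, which keeps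
  the d-fold product below exp(\<delta> d). If all entries ranged over the indices with eigenvalue
  above \<epsilon>^2, ln M would be o(1/\<epsilon>), and the extra factor ln(1/\<epsilon>) would
  spoil the bound. Splitting off the one exceptional entry lowers ln M to O(\<epsilon>^(-1/2)), and
  \<epsilon>^(-1/2) ln(1/\<epsilon>) is o(1/\<epsilon>). On the operator side, S_1 may have a large
  kernel and H_1 may be nonseparable. Completeness of the countable system of singular vectors is
  therefore expressed by S_1 vanishing on its orthogonal complement.\<close>

lemma riesz_representation:
  fixes \<phi> :: "'a::{real_inner, complete_space} \<Rightarrow> real"
  assumes "bounded_linear \<phi>"
  shows "\<exists>z. \<forall>v. \<phi> v = z \<bullet> v"
proof -
  interpret bounded_linear \<phi> by fact
  obtain K where K: "\<And>x. norm (\<phi> x) \<le> norm x * K"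
    using bounded by blast
  \<comment> \<open>If \<open>z\<close> represents \<open>\<phi>\<close>, then \<open>J x\<close> is
    the squared distance of \<open>x\<close> from \<open>z\<close> minus the constant
    \<open>z \<bullet> z\<close>. The representer is therefore sought as a minimiser of
    \<open>J\<close>.\<close>
  define J where "J x = x \<bullet> x - 2 * \<phi> x" for x
  have lower: "- (K\<^sup>2) \<le> J x" for x
  proof -
    have "0 \<le> (norm x - K)\<^sup>2" by simp
    moreover have "\<phi> x \<le> norm x * K" using K[of x] by simp
    ultimately show ?thesis
      by (simp add: J_def power2_diff power2_norm_eq_inner)
  qed
  then have bdd: "bdd_below (range J)" by (auto intro!: bdd_belowI)
  define m where "m = Inf (range J)"
  have m_le: "m \<le> J x" for x
    unfolding m_def by (rule cInf_lower) (auto simp: bdd)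
  have "\<exists>x. J x < m + inverse (real (Suc n))" for n
    using cInf_lessD[of "range J" "m + inverse (real (Suc n))"] by (auto simp: m_def)
  then obtain X where X: "\<And>n. J (X n) < m + inverse (real (Suc n))" by metis
  \<comment> \<open>The midpoint has \<open>J\<close> at least \<open>m\<close>, so two points with
    \<open>J\<close> below m + e^2/4 have squared distance below e^2. Minimising sequences are thus
    Cauchy.\<close>
  have parallelogram: "(norm (x - y))\<^sup>2 = 2 * J x + 2 * J y - 4 * J ((1/2) *\<^sub>R (x + y))" for x y
    by (simp add: J_def power2_norm_eq_inner add scaleR inner_simps inner_commute field_simps)
  have "Cauchy X"
  proof (rule metric_CauchyI)
    fix e :: real assume "0 < e"
    then obtain N where N: "inverse (real (Suc N)) < e\<^sup>2 / 4"
      using reals_Archimedean[of "e\<^sup>2 / 4"] by auto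
    have "dist (X i) (X j) < e" if "i \<ge> N" "j \<ge> N" for i j
    proof -
      have "J (X k) < m + e\<^sup>2 / 4" if "k \<ge> N" for k
      proof -
        have "inverse (real (Suc k)) \<le> inverse (real (Suc N))" using that by (simp add: field_simps)
        with X[of k] N show ?thesis by linarith
      qed
      from this[OF \<open>i \<ge> N\<close>] this[OF \<open>j \<ge> N\<close>] m_le[of "(1/2) *\<^sub>R (X i + X j)"]
      have "(norm (X i - X j))\<^sup>2 < e\<^sup>2" unfolding parallelogram by linarith
      then show ?thesis using \<open>0 < e\<close> by (simp add: dist_norm power2_less_imp_less)
    qed
    then show "\<exists>M. \<forall>m\<ge>M. \<forall>n\<ge>M. dist (X m) (X n) < e" by blast
  qed
  then obtain z where z: "X \<longlonglongrightarrow> z" using Cauchy_convergent convergent_def by blast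
  have "(\<lambda>n. J (X n)) \<longlonglongrightarrow> J z"
    unfolding J_def by (intro tendsto_intros tendsto z)
  moreover have "(\<lambda>n. m + inverse (real (Suc n))) \<longlonglongrightarrow> m"
    using tendsto_add[OF tendsto_const LIMSEQ_inverse_real_of_nat, of m] by simp
  ultimately have "J z \<le> m"
    by (rule LIMSEQ_le) (use X in \<open>auto intro: less_imp_le\<close>)
  have "\<phi> v = z \<bullet> v" for v
  proof (cases "v = 0")
    case False
    define a where "a = z \<bullet> v - \<phi> v"
    \<comment> \<open>This \<open>t\<close> minimises the quadratic polynomial
      \<open>J (z + t *\<^sub>R v)\<close>, whose linear coefficient is 2a. Unless \<open>a\<close>
      is 0, its value there falls below \<open>J z\<close>.\<close>
    define t where "t = - a / (v \<bullet> v)"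
    have "J z \<le> J (z + t *\<^sub>R v)" using \<open>J z \<le> m\<close> m_le order_trans by blast
    then have "0 \<le> 2 * t * a + t\<^sup>2 * (v \<bullet> v)"
      by (simp add: J_def a_def add scaleR inner_simps inner_commute power2_eq_square algebra_simps)
    also have "\<dots> = - (a\<^sup>2 / (v \<bullet> v))" using False
      by (simp add: t_def power2_eq_square field_simps)
    finally have "a\<^sup>2 / (v \<bullet> v) \<le> 0" by simp
    then have "a = 0" using False by (simp add: divide_le_0_iff inner_gt_zero_iff[symmetric] del: inner_gt_zero_iff)
    then show ?thesis by (simp add: a_def)
  qed (simp add: zero)
  then show ?thesis by blast
qed

text \<open>\<open>adjoint\<close> is a choice operator, so its defining property is available only
  once some adjoint is known to exist; the Riesz representation supplies one.\<close>

lemma adjoint_works_hilbert: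
  fixes T :: "'a::{real_inner, complete_space} \<Rightarrow> 'b::real_inner"
  assumes "bounded_linear T"
  shows "T x \<bullet> y = x \<bullet> adjoint T y"
proof -
  have "\<exists>z. \<forall>v. T v \<bullet> y = z \<bullet> v" for y
    by (rule riesz_representation[OF bounded_linear_inner_left_comp[OF assms]])
  then obtain f where "\<And>y v. T v \<bullet> y = f y \<bullet> v" by metis
  then have "\<exists>f. \<forall>x y. T x \<bullet> y = x \<bullet> f y" by (auto simp: inner_commute)
  from someI_ex[OF this] show ?thesis unfolding adjoint_def by blast
qed

lemma bounded_linear_adjoint:
  fixes T :: "'a::{real_inner, complete_space} \<Rightarrow> 'b::real_inner"
  assumes "bounded_linear T"
  shows "bounded_linear (adjoint T)"
proof -
  note adj = adjoint_works_hilbert[OF assms]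
  obtain K where K: "\<And>x. norm (T x) \<le> norm x * K" "K > 0"
    using assms bounded_linear.pos_bounded by blast
  show ?thesis
  proof (rule bounded_linear_intro[where K = K])
    fix x y :: 'b and r :: real
    have "v \<bullet> adjoint T (x + y) = v \<bullet> (adjoint T x + adjoint T y)" for v
      by (simp only: adj[symmetric] inner_add_right)
    then show "adjoint T (x + y) = adjoint T x + adjoint T y" by (rule vector_eq_ldot[THEN iffD1, OF allI])
    have "v \<bullet> adjoint T (r *\<^sub>R x) = v \<bullet> (r *\<^sub>R adjoint T x)" for v
      by (simp only: adj[symmetric] inner_scaleR_right)
    then show "adjoint T (r *\<^sub>R x) = r *\<^sub>R adjoint T x" by (rule vector_eq_ldot[THEN iffD1, OF allI])
    have "(norm (adjoint T x))\<^sup>2 = T (adjoint T x) \<bullet> x"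
      by (simp add: adj power2_norm_eq_inner)
    also have "\<dots> \<le> norm (T (adjoint T x)) * norm x" by (rule norm_cauchy_schwarz)
    also have "\<dots> \<le> norm (adjoint T x) * K * norm x" by (intro mult_right_mono K) simp
    finally have "norm (adjoint T x) * norm (adjoint T x) \<le> norm (adjoint T x) * (norm x * K)"
      by (simp add: power2_eq_square mult_ac)
    then show "norm (adjoint T x) \<le> norm x * K"
      using K(2) by (cases "adjoint T x = 0") (simp_all add: mult_le_cancel_left_pos)
  qed
qed

section \<open>Compactness and the eigenvectors of \<open>adjoint T \<circ> T\<close>\<close>

lemma compact_operator_bounded_linear:
  assumes "compact_operator T"
  shows "bounded_linear T"
proof -
  have lin: "linear T" and cpt: "compact (closure (T ` cball 0 1))"
    using assms bounded_cball unfolding compact_operator_def by blast+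
  have "bounded (T ` cball 0 1)"
    by (rule bounded_subset[OF compact_imp_bounded[OF cpt] closure_subset])
  then obtain K where "\<forall>y\<in>T ` cball 0 1. norm y \<le> K"
    unfolding bounded_iff by blast
  then have K: "norm (T x) \<le> K" if "norm x \<le> 1" for x
    using that by simp
  have "norm (T x) \<le> norm x * K" for x
  proof (cases "x = 0")
    case False
    have "norm (T x) = norm x * norm (T (x /\<^sub>R norm x))"
      using False by (simp add: linear_scale[OF lin])
    also have "\<dots> \<le> norm x * K" using False by (intro mult_left_mono K) auto
    finally show ?thesis .
  qed (simp add: linear_0[OF lin])
  then show ?thesis
    using lin by (intro bounded_linear_intro[where K = K]) (auto simp: linear_add linear_scale)
qed

lemma compact_operator_convergent_subseq:
  assumes "compact_operator T" "\<And>n. norm (x n) \<le> 1"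
  obtains r l where "strict_mono (r :: nat \<Rightarrow> nat)" "(\<lambda>n. T (x (r n))) \<longlonglongrightarrow> l"
proof -
  have "seq_compact (closure (T ` cball 0 1))"
    using assms(1) by (auto simp: compact_operator_def intro: compact_imp_seq_compact)
  moreover have "\<forall>n. T (x n) \<in> closure (T ` cball 0 1)"
    using assms(2) closure_subset by fastforce
  ultimately show thesis
    by (elim seq_compactE[where f = "\<lambda>n. T (x n)"]) (auto simp: o_def intro: that)
qed

text \<open>Orthogonal images of norm at least \<open>c\<close> lie at mutual distance at least
  \<open>c\<close>, so no sequence of them has a Cauchy subsequence. This later bounds the number of
  eigenvalues above a positive threshold.\<close>

lemma compact_operator_orthogonal_image_small:
  assumes T: "compact_operator T" and "infinite A"
    and norm: "\<And>x. x \<in> A \<Longrightarrow> norm x \<le> 1"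
    and orth: "\<And>x y. x \<in> A \<Longrightarrow> y \<in> A \<Longrightarrow> x \<noteq> y \<Longrightarrow> T x \<bullet> T y = 0"
    and "c > 0"
  shows "\<exists>x\<in>A. norm (T x) < c"
proof (rule ccontr)
  assume "\<not> ?thesis"
  then have big: "c \<le> norm (T x)" if "x \<in> A" for x using that by force
  obtain f :: "nat \<Rightarrow> 'a" where f: "inj f" "range f \<subseteq> A"
    using infinite_countable_subset[OF \<open>infinite A\<close>] by blast
  then have fA: "f n \<in> A" for n by blast
  obtain r l where r: "strict_mono r" "(\<lambda>n. T (f (r n))) \<longlonglongrightarrow> l"
    using compact_operator_convergent_subseq[OF T, of f] norm fA by blast
  then have "Cauchy (\<lambda>n. T (f (r n)))" using LIMSEQ_imp_Cauchy by blast
  then obtain N where N: "dist (T (f (r (Suc N)))) (T (f (r N))) < c"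
    using metric_CauchyD[of _ c] \<open>c > 0\<close> by (meson le_SucI order_refl)
  define x y where "x = f (r (Suc N))" and "y = f (r N)"
  have "x \<noteq> y" using f(1) r(1) by (simp add: x_def y_def inj_eq strict_mono_eq)
  have xy: "x \<in> A" "y \<in> A" by (simp_all add: x_def y_def fA)
  have "(norm (T x))\<^sup>2 \<le> (norm (T x - T y))\<^sup>2"
    using orth[OF xy \<open>x \<noteq> y\<close>] by (simp add: power2_norm_eq_inner inner_simps inner_commute)
  then have "norm (T x) \<le> norm (T x - T y)" by (rule power2_le_imp_le) simp
  with big[OF xy(1)] N show False by (simp add: dist_norm x_def y_def)
qed

text \<open>A maximiser of \<open>norm (T x)\<close> on the unit ball of \<open>V\<close> is an
  eigenvector, with the squared maximum as eigenvalue; compactness provides it. Working inside an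
  invariant closed subspace allows the lemma to be applied to the orthogonal complement of
  eigenvectors already found.\<close>

lemma compact_operator_eigenvector:
  fixes T :: "'a::{real_inner, complete_space} \<Rightarrow> 'b::{real_inner, complete_space}"
  assumes T: "compact_operator T" and V: "subspace V" "closed V"
    and inv: "\<And>x. x \<in> V \<Longrightarrow> adjoint T (T x) \<in> V"
    and "w \<in> V" "T w \<noteq> 0"
  shows "\<exists>v\<in>V. \<exists>\<mu>>0. norm v = 1 \<and> adjoint T (T v) = \<mu> *\<^sub>R v"
proof -
  have bl: "bounded_linear T" and bla: "bounded_linear (adjoint T)"
    using T compact_operator_bounded_linear bounded_linear_adjoint by blast+
  interpret T: bounded_linear T by fact
  interpret A: bounded_linear "adjoint T" by fact
  note adj = adjoint_works_hilbert[OF bl]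
  obtain K where K: "\<And>x. norm (T x) \<le> norm x * K" "K > 0"
    using T.pos_bounded by blast
  define U where "U = (\<lambda>x. norm (T x)) ` (V \<inter> cball 0 1)"
  define s where "s = Sup U"
  have "norm (T x) \<le> K" if "norm x \<le> 1" for x
  proof -
    have "norm x * K \<le> 1 * K" using that K(2) by (intro mult_right_mono) auto
    with K(1)[of x] show ?thesis by simp
  qed
  then have bdd: "bdd_above U" by (auto simp: U_def intro!: bdd_aboveI)
  have le_s: "norm (T x) \<le> s" if "x \<in> V" "norm x \<le> 1" for x
    unfolding s_def by (rule cSup_upper) (use that bdd in \<open>auto simp: U_def\<close>)
  have bound: "norm (T x) \<le> s * norm x" if "x \<in> V" for x
  proof (cases "x = 0")
    case False
    have "norm (T (x /\<^sub>R norm x)) \<le> s"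
      using that False by (intro le_s subspace_scale V) auto
    then show ?thesis using False by (simp add: T.scaleR field_simps)
  qed (simp add: T.zero)
  have "w \<noteq> 0" using \<open>T w \<noteq> 0\<close> T.zero by blast
  have "0 < norm (T w)" using \<open>T w \<noteq> 0\<close> by simp
  also have "\<dots> \<le> s * norm w" by (rule bound) fact
  finally have "s > 0" using \<open>w \<noteq> 0\<close> by (simp add: zero_less_mult_iff)
  have "\<exists>x\<in>V \<inter> cball 0 1. s - inverse (real (Suc n)) < norm (T x)" for n
  proof -
    have "U \<noteq> {}" using \<open>subspace V\<close> by (auto simp: U_def intro: exI[of _ 0] subspace_0)
    moreover have "s - inverse (real (Suc n)) < Sup U" by (simp add: s_def)
    ultimately have "\<exists>u\<in>U. s - inverse (real (Suc n)) < u" using less_cSupD by blast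
    then show ?thesis by (auto simp: U_def)
  qed
  then obtain X where XV: "\<And>n. X n \<in> V" and X1: "\<And>n. norm (X n) \<le> 1"
    and Xs: "\<And>n. s - inverse (real (Suc n)) < norm (T (X n))"
    by (metis IntE dist_0_norm mem_cball)
  obtain r l where r: "strict_mono r" and l: "(\<lambda>n. T (X (r n))) \<longlonglongrightarrow> l"
    using compact_operator_convergent_subseq[OF T, of X] X1 by blast
  have normT: "(\<lambda>n. norm (T (X (r n)))) \<longlonglongrightarrow> s"
  proof -
    have "(\<lambda>n. norm (T (X n))) \<longlonglongrightarrow> s"
    proof (rule real_tendsto_sandwich)
      show "(\<lambda>n. s - inverse (real (Suc n))) \<longlonglongrightarrow> s"
        using tendsto_diff[OF tendsto_const LIMSEQ_inverse_real_of_nat, of s] by simp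
      show "\<forall>\<^sub>F n in sequentially. s - inverse (real (Suc n)) \<le> norm (T (X n))"
        using Xs by (auto intro!: always_eventually less_imp_le)
    qed (use le_s XV X1 in auto)
    from LIMSEQ_subseq_LIMSEQ[OF this r] show ?thesis by (simp add: o_def)
  qed
  \<comment> \<open>Almost maximisers are almost eigenvectors: after expanding the square, only |T*
    T x| \<le> s |T x| and |x| \<le> 1 are left to insert, where T* is the adjoint. The former is
    the bound by \<open>s\<close> at the point T* T x, which lies in \<open>V\<close> by
    invariance.\<close>
  have defect: "(norm (adjoint T (T x) - s\<^sup>2 *\<^sub>R x))\<^sup>2 \<le> s\<^sup>2 * (s\<^sup>2 - (norm (T x))\<^sup>2)"
    if "x \<in> V" "norm x \<le> 1" for x
  proof -
    have "(norm (adjoint T (T x)))\<^sup>2 = T (adjoint T (T x)) \<bullet> T x"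
      by (simp add: adj power2_norm_eq_inner)
    also have "\<dots> \<le> norm (T (adjoint T (T x))) * norm (T x)" by (rule norm_cauchy_schwarz)
    also have "\<dots> \<le> s * norm (adjoint T (T x)) * norm (T x)"
      by (intro mult_right_mono bound inv that) simp
    finally have "norm (adjoint T (T x)) * norm (adjoint T (T x)) \<le> norm (adjoint T (T x)) * (s * norm (T x))"
      by (simp add: power2_eq_square mult_ac)
    then have "norm (adjoint T (T x)) \<le> s * norm (T x)"
      using \<open>s > 0\<close> by (cases "adjoint T (T x) = 0") (simp_all add: mult_le_cancel_left_pos)
    then have 1: "(norm (adjoint T (T x)))\<^sup>2 \<le> s\<^sup>2 * (norm (T x))\<^sup>2"
      by (metis norm_ge_zero power_mono power_mult_distrib)
    have "(norm x)\<^sup>2 \<le> 1" using that(2) by (simp add: power_le_one)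
    then have 2: "s^4 * (norm x)\<^sup>2 \<le> s^4"
      using \<open>s > 0\<close> by (simp add: mult_left_le)
    have "(norm (adjoint T (T x) - s\<^sup>2 *\<^sub>R x))\<^sup>2
        = (norm (adjoint T (T x)))\<^sup>2 - 2 * s\<^sup>2 * (x \<bullet> adjoint T (T x)) + s^4 * (norm x)\<^sup>2"
      unfolding power2_norm_eq_inner
      by (simp add: inner_diff_left inner_diff_right inner_commute
          power2_eq_square power4_eq_xxxx algebra_simps)
    also have "x \<bullet> adjoint T (T x) = (norm (T x))\<^sup>2"
      by (simp add: adj[symmetric] power2_norm_eq_inner)
    finally show ?thesis using 1 2 by (simp add: algebra_simps power4_eq_xxxx power2_eq_square)
  qed
  have "(\<lambda>n. (norm (adjoint T (T (X (r n))) - s\<^sup>2 *\<^sub>R X (r n)))\<^sup>2) \<longlonglongrightarrow> 0"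
  proof (rule real_tendsto_sandwich[where f = "\<lambda>_. 0"])
    have "(\<lambda>n. s\<^sup>2 * (s\<^sup>2 - (norm (T (X (r n))))\<^sup>2)) \<longlonglongrightarrow> s\<^sup>2 * (s\<^sup>2 - s\<^sup>2)"
      by (intro tendsto_intros normT)
    then show "(\<lambda>n. s\<^sup>2 * (s\<^sup>2 - (norm (T (X (r n))))\<^sup>2)) \<longlonglongrightarrow> 0" by simp
  qed (use defect XV X1 in \<open>auto intro!: always_eventually\<close>)
  then have "(\<lambda>n. norm (adjoint T (T (X (r n))) - s\<^sup>2 *\<^sub>R X (r n))) \<longlonglongrightarrow> 0"
    by simp
  then have lim0: "(\<lambda>n. adjoint T (T (X (r n))) - s\<^sup>2 *\<^sub>R X (r n)) \<longlonglongrightarrow> 0"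
    by (rule tendsto_norm_zero_cancel)
  \<comment> \<open>Compactness yields convergence of the images only. Since s^2 X differs from T* T
    X by a null sequence, the points \<open>X (r n)\<close> themselves converge, to this
    \<open>z\<close>.\<close>
  define z where "z = (1 / s\<^sup>2) *\<^sub>R adjoint T l"
  have "(\<lambda>n. (1 / s\<^sup>2) *\<^sub>R (adjoint T (T (X (r n))) - (adjoint T (T (X (r n))) - s\<^sup>2 *\<^sub>R X (r n))))
      \<longlonglongrightarrow> (1 / s\<^sup>2) *\<^sub>R (adjoint T l - 0)"
    by (intro tendsto_intros A.tendsto l lim0)
  then have Xz: "(\<lambda>n. X (r n)) \<longlonglongrightarrow> z" using \<open>s > 0\<close> by (simp add: z_def)
  have "z \<in> V" using closed_sequentially[OF V(2) _ Xz] XV by blast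
  have "(\<lambda>n. norm (T (X (r n)))) \<longlonglongrightarrow> norm (T z)" by (intro tendsto_intros T.tendsto Xz)
  then have "norm (T z) = s" using normT LIMSEQ_unique by blast
  then have "z \<noteq> 0" using \<open>s > 0\<close> T.zero by force
  have "(\<lambda>n. adjoint T (T (X (r n))) - s\<^sup>2 *\<^sub>R X (r n)) \<longlonglongrightarrow> adjoint T (T z) - s\<^sup>2 *\<^sub>R z"
    by (intro tendsto_intros A.tendsto T.tendsto Xz)
  then have Dz: "adjoint T (T z) = s\<^sup>2 *\<^sub>R z" using lim0 LIMSEQ_unique by fastforce
  show ?thesis
  proof (intro bexI exI conjI)
    show "norm (z /\<^sub>R norm z) = 1" using \<open>z \<noteq> 0\<close> by simp
    show "adjoint T (T (z /\<^sub>R norm z)) = s\<^sup>2 *\<^sub>R (z /\<^sub>R norm z)"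
      by (simp add: T.scaleR A.scaleR Dz)
  qed (use \<open>s > 0\<close> \<open>z \<in> V\<close> V(1) in \<open>auto intro: subspace_scale\<close>)
qed

text \<open>Zorn's lemma gives a maximal orthonormal set of eigenvectors with positive eigenvalues.
  Its orthogonal complement is invariant, so if \<open>T\<close> did not vanish there, the
  complement would contain a further eigenvector.\<close>

lemma compact_operator_eigenbasis:
  fixes T :: "'a::{real_inner, complete_space} \<Rightarrow> 'b::{real_inner, complete_space}"
  assumes T: "compact_operator T"
  obtains B where "pairwise orthogonal B" "\<And>b. b \<in> B \<Longrightarrow> norm b = 1"
    "\<And>b. b \<in> B \<Longrightarrow> \<exists>\<mu>>0. adjoint T (T b) = \<mu> *\<^sub>R b"
    "\<And>x. (\<And>b. b \<in> B \<Longrightarrow> x \<bullet> b = 0) \<Longrightarrow> T x = 0"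
proof -
  have bl: "bounded_linear T"
    using T by (rule compact_operator_bounded_linear)
  note adj = adjoint_works_hilbert[OF bl]
  define E where "E = {B. pairwise orthogonal B \<and>
    (\<forall>b\<in>B. norm b = 1 \<and> (\<exists>\<mu>>0. adjoint T (T b) = \<mu> *\<^sub>R b))}"
  have "\<exists>B\<in>E. \<forall>X\<in>E. B \<subseteq> X \<longrightarrow> X = B"
  proof (rule subset_Zorn')
    fix C assume C: "subset.chain E C"
    have "orthogonal x y" if xy: "x \<in> X" "X \<in> C" "y \<in> Y" "Y \<in> C" "x \<noteq> y" for x y X Y
    proof -
      from C xy have "X \<subseteq> Y \<or> Y \<subseteq> X" and "X \<in> E" "Y \<in> E"
        by (auto simp: subset_chain_def)
      then show ?thesis using xy by (auto simp: E_def pairwise_def)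
    qed
    then show "\<Union>C \<in> E"
      using C by (auto simp: E_def subset_chain_def pairwise_def)
  qed
  then obtain B where "B \<in> E" and max: "\<And>X. X \<in> E \<Longrightarrow> B \<subseteq> X \<Longrightarrow> X = B" by blast
  have orth: "pairwise orthogonal B" and n1: "\<And>b. b \<in> B \<Longrightarrow> norm b = 1"
    and eig: "\<And>b. b \<in> B \<Longrightarrow> \<exists>\<mu>>0. adjoint T (T b) = \<mu> *\<^sub>R b"
    using \<open>B \<in> E\<close> by (auto simp: E_def)
  have "T x = 0" if x: "\<And>b. b \<in> B \<Longrightarrow> x \<bullet> b = 0" for x
  proof (rule ccontr)
    assume "T x \<noteq> 0"
    define V where "V = {x. \<forall>b\<in>B. x \<bullet> b = 0}"
    have "subspace V" by (auto simp: V_def subspace_def inner_simps)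
    have "V = (\<Inter>b\<in>B. {x. x \<bullet> b = 0})" by (auto simp: V_def)
    then have "closed V"
      by (auto intro!: closed_INT closed_Collect_eq continuous_intros)
    have inv: "adjoint T (T y) \<in> V" if "y \<in> V" for y
    proof -
      have "adjoint T (T y) \<bullet> b = 0" if "b \<in> B" for b
      proof -
        obtain \<mu> where "adjoint T (T b) = \<mu> *\<^sub>R b" using eig \<open>b \<in> B\<close> by blast
        then have "adjoint T (T y) \<bullet> b = \<mu> * (y \<bullet> b)"
          by (metis adj inner_commute inner_scaleR_right)
        then show ?thesis using \<open>y \<in> V\<close> \<open>b \<in> B\<close> by (simp add: V_def)
      qed
      then show ?thesis by (simp add: V_def)
    qed
    obtain v \<mu> where v: "v \<in> V" "norm v = 1" "\<mu> > 0" "adjoint T (T v) = \<mu> *\<^sub>R v"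
      using compact_operator_eigenvector[OF T \<open>subspace V\<close> \<open>closed V\<close> inv _ \<open>T x \<noteq> 0\<close>] x
      by (auto simp: V_def)
    have "insert v B \<in> E"
      using \<open>B \<in> E\<close> v by (auto simp: E_def V_def pairwise_insert orthogonal_def inner_commute)
    then have "v \<in> B" using max by blast
    then have "v \<bullet> v = 0" using v(1) by (simp add: V_def)
    then show False using v(2) by simp
  qed
  then show thesis using that orth n1 eig by blast
qed


text \<open>The basis from Zorn's lemma carries no order, while \<open>lam\<close> lists the
  eigenvalues with multiplicity. The two are matched one eigenvalue at a time, both fibres having as
  many elements as the eigenspace has dimensions. Only indices with \<open>lam m > 0\<close> receive
  a meaningful vector.\<close>

lemma compact_operator_singular_values:
  fixes T :: "'a::{real_inner, complete_space} \<Rightarrow> 'b::{real_inner, complete_space}"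
  assumes T: "compact_operator T" and lam: "eigenvalue_sequence (adjoint T \<circ> T) lam"
  obtains e where
    "\<And>m n. \<lbrakk>1 \<le> m; 1 \<le> n; lam m > 0; lam n > 0\<rbrakk> \<Longrightarrow> e m \<bullet> e n = (if m = n then 1 else 0)"
    "\<And>m n. \<lbrakk>1 \<le> m; 1 \<le> n; lam m > 0; lam n > 0\<rbrakk> \<Longrightarrow> T (e m) \<bullet> T (e n) = (if m = n then lam m else 0)"
    "\<And>x. (\<And>m. 1 \<le> m \<Longrightarrow> lam m > 0 \<Longrightarrow> x \<bullet> e m = 0) \<Longrightarrow> T x = 0"
    "lam \<longlonglongrightarrow> 0"
proof -
  have bl: "bounded_linear T" and bla: "bounded_linear (adjoint T)"
    using T compact_operator_bounded_linear bounded_linear_adjoint by blast+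
  interpret T: bounded_linear T by fact
  interpret A: bounded_linear "adjoint T" by fact
  note adj = adjoint_works_hilbert[OF bl]
  have nonneg: "0 \<le> lam m" if "1 \<le> m" for m
    using lam that by (auto simp: eigenvalue_sequence_def)
  obtain B where orth: "pairwise orthogonal B" and n1: "\<And>b. b \<in> B \<Longrightarrow> norm b = 1"
    and eig: "\<And>b. b \<in> B \<Longrightarrow> \<exists>\<mu>>0. adjoint T (T b) = \<mu> *\<^sub>R b"
    and complete: "\<And>x. (\<And>b. b \<in> B \<Longrightarrow> x \<bullet> b = 0) \<Longrightarrow> T x = 0"
    using compact_operator_eigenbasis[OF T] by blast
  have "\<forall>b. \<exists>\<mu>. b \<in> B \<longrightarrow> \<mu> > 0 \<and> adjoint T (T b) = \<mu> *\<^sub>R b" using eig by blast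
  then obtain \<mu> where \<mu>pos: "\<And>b. b \<in> B \<Longrightarrow> \<mu> b > 0"
    and \<mu>: "\<And>b. b \<in> B \<Longrightarrow> adjoint T (T b) = \<mu> b *\<^sub>R b" by metis
  have B_inner: "x \<bullet> y = (if x = y then 1 else 0)" if "x \<in> B" "y \<in> B" for x y
    using that orth n1 by (auto simp: pairwise_def orthogonal_def norm_eq_1)
  have T_inner: "T x \<bullet> T y = (if x = y then \<mu> x else 0)" if "x \<in> B" "y \<in> B" for x y
    using that \<mu>[of y] B_inner[of x y] by (simp add: adj)
  have finite_ge: "finite {b \<in> B. c \<le> \<mu> b}" if "c > 0" for c
  proof (rule ccontr)
    assume "infinite {b \<in> B. c \<le> \<mu> b}"
    then have "\<exists>b\<in>{b \<in> B. c \<le> \<mu> b}. norm (T b) < sqrt c"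
      using \<open>c > 0\<close> by (intro compact_operator_orthogonal_image_small[OF T]) (auto simp: n1 T_inner)
    then show False by (auto simp: norm_eq_sqrt_inner T_inner)
  qed
  define E where "E c = {b \<in> B. \<mu> b = c}" for c
  have card_E: "finite (E c)" "card (E c) = dim {x. (adjoint T \<circ> T) x = c *\<^sub>R x}" if "c > 0" for c
  proof -
    show fin: "finite (E c)"
      by (rule finite_subset[OF _ finite_ge[OF that]]) (auto simp: E_def)
    have "{x. (adjoint T \<circ> T) x = c *\<^sub>R x} \<subseteq> span (E c)"
    proof
      fix x assume "x \<in> {x. (adjoint T \<circ> T) x = c *\<^sub>R x}"
      then have x: "adjoint T (T x) = c *\<^sub>R x" by simp
      \<comment> \<open>\<open>p\<close> is the projection of \<open>x\<close> to the span of
        \<open>E c\<close>. The difference \<open>x - p\<close> is again an eigenvector for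
        \<open>c\<close> or 0, hence orthogonal to basis vectors with other eigenvalues, and by
        construction to those in \<open>E c\<close>. So \<open>T\<close> kills it, and c > 0 forces
        it to be 0.\<close>
      define p where "p = (\<Sum>b\<in>E c. (x \<bullet> b) *\<^sub>R b)"
      have p: "adjoint T (T p) = c *\<^sub>R p"
        by (simp add: p_def T.sum T.scaleR A.sum A.scaleR scaleR_right.sum E_def \<mu> mult.commute)
      have D: "adjoint T (T (x - p)) = c *\<^sub>R (x - p)"
        by (simp add: x p T.diff A.diff scaleR_right_diff_distrib)
      have "T (x - p) = 0"
      proof (rule complete)
        fix b assume "b \<in> B"
        have "c * ((x - p) \<bullet> b) = b \<bullet> adjoint T (T (x - p))"
          unfolding D by (simp only: inner_scaleR_right inner_commute)
        also have "\<dots> = T b \<bullet> T (x - p)" by (simp only: adj)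
        also have "\<dots> = T (x - p) \<bullet> T b" by (rule inner_commute)
        also have "\<dots> = \<mu> b * ((x - p) \<bullet> b)" by (simp add: adj \<mu> \<open>b \<in> B\<close>)
        finally have "\<mu> b = c \<or> (x - p) \<bullet> b = 0" by auto
        moreover have "(x - p) \<bullet> b = 0" if "\<mu> b = c"
        proof -
          have "b \<in> E c" using that \<open>b \<in> B\<close> by (simp add: E_def)
          have "p \<bullet> b = (\<Sum>a\<in>E c. (x \<bullet> a) * (if a = b then 1 else 0))"
            unfolding p_def inner_sum_left
            by (intro sum.cong) (use \<open>b \<in> B\<close> B_inner in \<open>auto simp: E_def\<close>)
          also have "\<dots> = x \<bullet> b" using fin \<open>b \<in> E c\<close> by (simp add: if_distrib cong: if_cong)
          finally show ?thesis by (simp add: inner_diff_left)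
        qed
        ultimately show "(x - p) \<bullet> b = 0" by blast
      qed
      then have "x = p" using D \<open>c > 0\<close> by (simp add: A.zero)
      moreover have "p \<in> span (E c)"
        unfolding p_def by (intro span_sum span_scale span_base)
      ultimately show "x \<in> span (E c)" by simp
    qed
    moreover have "independent (E c)"
    proof (rule pairwise_orthogonal_independent)
      show "pairwise orthogonal (E c)" using orth by (auto simp: E_def pairwise_def)
      show "0 \<notin> E c" using n1 by (force simp: E_def)
    qed
    moreover have "E c \<subseteq> {x. (adjoint T \<circ> T) x = c *\<^sub>R x}" by (auto simp: E_def \<mu>)
    ultimately show "card (E c) = dim {x. (adjoint T \<circ> T) x = c *\<^sub>R x}"
      by (simp add: dim_unique)
  qed
  have "\<exists>f. bij_betw f {m. 1 \<le> m \<and> lam m = c} (E c)" if "c > 0" for c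
    using lam that card_E[OF that] by (intro finite_same_card_bij) (auto simp: eigenvalue_sequence_def)
  then obtain f where f: "\<And>c. c > 0 \<Longrightarrow> bij_betw (f c) {m. 1 \<le> m \<and> lam m = c} (E c)" by metis
  \<comment> \<open>The bijections for different eigenvalues are glued; the fibres
    \<open>E c\<close> are disjoint, so the result is injective.\<close>
  define e where "e m = f (lam m) m" for m
  have eE: "e m \<in> E (lam m)" if "1 \<le> m" "lam m > 0" for m
    using bij_betwE[OF f[OF that(2)]] that by (auto simp: e_def)
  then have eB: "e m \<in> B" and e\<mu>: "\<mu> (e m) = lam m" if "1 \<le> m" "lam m > 0" for m
    using that by (auto simp: E_def)
  have e_eq: "e m = e n \<longleftrightarrow> m = n" if "1 \<le> m" "lam m > 0" "1 \<le> n" "lam n > 0" for m n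
  proof
    assume "e m = e n"
    then have "lam m = lam n" using e\<mu> that by metis
    then show "m = n"
      using \<open>e m = e n\<close> bij_betw_imp_inj_on[OF f[OF that(2)]] that by (auto simp: e_def dest: inj_onD)
  qed simp
  have e_surj: "\<exists>m\<ge>1. lam m > 0 \<and> e m = b" if "b \<in> B" for b
  proof -
    have "b \<in> f (\<mu> b) ` {m. 1 \<le> m \<and> lam m = \<mu> b}"
      using bij_betw_imp_surj_on[OF f[OF \<mu>pos[OF that]]] that by (auto simp: E_def)
    then show ?thesis using \<mu>pos[OF that] by (auto simp: e_def)
  qed
  show thesis
  proof (rule that)
    show "e m \<bullet> e n = (if m = n then 1 else 0)"
      if "1 \<le> m" "1 \<le> n" "lam m > 0" "lam n > 0" for m n
      using that by (simp add: B_inner eB e_eq)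
    show "T (e m) \<bullet> T (e n) = (if m = n then lam m else 0)"
      if "1 \<le> m" "1 \<le> n" "lam m > 0" "lam n > 0" for m n
      using that by (simp add: T_inner eB e_eq e\<mu>)
    show "T x = 0" if "\<And>m. 1 \<le> m \<Longrightarrow> lam m > 0 \<Longrightarrow> x \<bullet> e m = 0" for x
      using complete e_surj that by metis
    show "lam \<longlonglongrightarrow> 0"
    proof (rule LIMSEQ_I)
      fix c :: real assume "c > 0"
      have "inj_on e {m. 1 \<le> m \<and> c \<le> lam m}"
        using \<open>c > 0\<close> by (auto intro!: inj_onI simp: e_eq)
      moreover have "e ` {m. 1 \<le> m \<and> c \<le> lam m} \<subseteq> {b \<in> B. c \<le> \<mu> b}"
        using \<open>c > 0\<close> by (auto simp: eB e\<mu>)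
      ultimately have "finite {m. 1 \<le> m \<and> c \<le> lam m}"
        using finite_ge[OF \<open>c > 0\<close>] by (meson finite_imageD finite_subset)
      then obtain k where k: "\<And>m. 1 \<le> m \<Longrightarrow> c \<le> lam m \<Longrightarrow> m \<le> k"
        by (auto simp: finite_nat_set_iff_bounded_le)
      have "norm (lam m - 0) < c" if "m \<ge> Suc k" for m
        using k[of m] nonneg[of m] that by (force simp: not_le)
      then show "\<exists>no. \<forall>n\<ge>no. norm (lam n - 0) < c" by blast
    qed
  qed
qed

section \<open>Orthonormal systems and Fourier expansions\<close>

lemma norm_sum_orthogonal:
  fixes v :: "'i \<Rightarrow> 'a::real_inner"
  assumes "finite A" "\<And>i j. i \<in> A \<Longrightarrow> j \<in> A \<Longrightarrow> v i \<bullet> v j = (if i = j then w i else 0)"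
  shows "(norm (\<Sum>i\<in>A. c i *\<^sub>R v i))\<^sup>2 = (\<Sum>i\<in>A. (c i)\<^sup>2 * w i)"
proof -
  have "(norm (\<Sum>i\<in>A. c i *\<^sub>R v i))\<^sup>2 = (\<Sum>i\<in>A. \<Sum>j\<in>A. c i * (c j * (v i \<bullet> v j)))"
    unfolding power2_norm_eq_inner inner_sum_left
    by (simp add: inner_sum_right sum_distrib_left mult.left_commute)
  also have "\<dots> = (\<Sum>i\<in>A. \<Sum>j\<in>A. if i = j then c i * (c j * w i) else 0)"
    by (intro sum.cong) (auto simp: assms(2))
  also have "\<dots> = (\<Sum>i\<in>A. (c i)\<^sup>2 * w i)"
    using \<open>finite A\<close> by (simp add: power2_eq_square mult.assoc)
  finally show ?thesis .
qed

lemma bessel_inequality: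
  fixes e :: "'i \<Rightarrow> 'a::real_inner"
  assumes "finite A" "\<And>i j. i \<in> A \<Longrightarrow> j \<in> A \<Longrightarrow> e i \<bullet> e j = (if i = j then 1 else 0)"
  shows "(\<Sum>i\<in>A. (x \<bullet> e i)\<^sup>2) \<le> (norm x)\<^sup>2"
proof -
  define p where "p = (\<Sum>i\<in>A. (x \<bullet> e i) *\<^sub>R e i)"
  have "(norm p)\<^sup>2 = (\<Sum>i\<in>A. (x \<bullet> e i)\<^sup>2)"
    unfolding p_def by (subst norm_sum_orthogonal[where w = "\<lambda>_. 1"]) (use assms in auto)
  moreover have "x \<bullet> p = (\<Sum>i\<in>A. (x \<bullet> e i)\<^sup>2)"
    by (simp add: p_def inner_sum_right power2_eq_square)
  moreover have "(norm (x - p))\<^sup>2 = (norm x)\<^sup>2 - 2 * (x \<bullet> p) + (norm p)\<^sup>2"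
    by (simp add: power2_norm_eq_inner inner_diff_left inner_diff_right inner_commute)
  ultimately show ?thesis using zero_le_power2[of "norm (x - p)"] by linarith
qed

text \<open>The Fourier series of \<open>x\<close> converges by Bessel's inequality and completeness
  of the space. Its sum \<open>p\<close> may differ from \<open>x\<close>, but \<open>x - p\<close>
  is orthogonal to the system and so is killed by \<open>T\<close>.\<close>

lemma orthonormal_expansion_image:
  fixes T :: "'a::{real_inner, complete_space} \<Rightarrow> 'b::real_normed_vector" and e :: "nat \<Rightarrow> 'a"
  assumes "bounded_linear T"
    and orth: "\<And>m n. m \<in> A \<Longrightarrow> n \<in> A \<Longrightarrow> e m \<bullet> e n = (if m = n then 1 else 0)"
    and null: "\<And>x. (\<And>m. m \<in> A \<Longrightarrow> x \<bullet> e m = 0) \<Longrightarrow> T x = 0"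
  shows "(\<lambda>M. \<Sum>m\<in>A \<inter> {..<M}. (x \<bullet> e m) *\<^sub>R T (e m)) \<longlonglongrightarrow> T x"
proof -
  interpret T: bounded_linear T by fact
  \<comment> \<open>Extension by 0 outside \<open>A\<close> turns the partial sums over
    \<open>A\<close> into ordinary series over the naturals.\<close>
  define u where "u m = (if m \<in> A then e m else 0)" for m
  define a where "a m = (x \<bullet> u m) *\<^sub>R u m" for m
  have u_inner: "u m \<bullet> u n = (if m = n then (if m \<in> A then 1 else 0) else 0)" for m n
    by (simp add: u_def orth)
  have norm_a: "(norm (sum a I))\<^sup>2 = (\<Sum>m\<in>I. (x \<bullet> u m)\<^sup>2)" if "finite I" for I
  proof -
    have "(norm (sum a I))\<^sup>2 = (\<Sum>m\<in>I. (x \<bullet> u m)\<^sup>2 * (if m \<in> A then 1 else 0))"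
      unfolding a_def using that by (rule norm_sum_orthogonal) (rule u_inner)
    also have "\<dots> = (\<Sum>m\<in>I. (x \<bullet> u m)\<^sup>2)" by (intro sum.cong) (auto simp: u_def)
    finally show ?thesis .
  qed
  have "summable (\<lambda>m. (x \<bullet> u m)\<^sup>2)"
  proof (rule summableI_nonneg_bounded)
    fix n
    have "(\<Sum>m<n. (x \<bullet> u m)\<^sup>2) = (\<Sum>m\<in>A \<inter> {..<n}. (x \<bullet> e m)\<^sup>2)"
      by (rule sum.mono_neutral_cong_right) (auto simp: u_def)
    also have "\<dots> \<le> (norm x)\<^sup>2" by (rule bessel_inequality) (auto simp: orth)
    finally show "(\<Sum>m<n. (x \<bullet> u m)\<^sup>2) \<le> (norm x)\<^sup>2" .
  qed simp
  have "Cauchy (\<lambda>M. \<Sum>m<M. a m)"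
  proof (subst Cauchy_altdef, intro allI impI)
    fix r :: real assume "r > 0"
    then obtain N where N: "\<And>m n. m \<ge> N \<Longrightarrow> norm (\<Sum>k\<in>{m..<n}. (x \<bullet> u k)\<^sup>2) < r\<^sup>2"
      using \<open>summable (\<lambda>m. (x \<bullet> u m)\<^sup>2)\<close> unfolding summable_Cauchy by (meson zero_less_power)
    have "dist (sum a {..<m}) (sum a {..<n}) < r" if "m \<ge> N" "n > m" for m n
    proof (rule power2_less_imp_less)
      have "sum a {..<n} - sum a {..<m} = sum a {m..<n}"
        using that(2) by (subst sum_diff[symmetric]) (auto intro: sum.cong)
      then show "(dist (sum a {..<m}) (sum a {..<n}))\<^sup>2 < r\<^sup>2"
        using N[OF that(1), of n] by (simp add: dist_commute[of "sum a {..<m}"]) (simp add: dist_norm norm_a sum_nonneg)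
    qed (use \<open>r > 0\<close> in simp)
    then show "\<exists>N. \<forall>m\<ge>N. \<forall>n>m. dist (sum a {..<m}) (sum a {..<n}) < r" by blast
  qed
  then obtain p where "a sums p" by (auto simp: sums_def dest: Cauchy_convergent convergentD)
  have "T (x - p) = 0"
  proof (rule null)
    fix m assume "m \<in> A"
    have "(\<lambda>k. a k \<bullet> e m) sums (p \<bullet> e m)"
      by (rule bounded_linear.sums[OF bounded_linear_inner_left \<open>a sums p\<close>])
    moreover have "(\<lambda>k. a k \<bullet> e m) = (\<lambda>k. if k = m then x \<bullet> e m else 0)"
      using \<open>m \<in> A\<close> by (auto simp: a_def u_def orth)
    then have "(\<lambda>k. a k \<bullet> e m) sums (x \<bullet> e m)" using sums_single[of m "\<lambda>_. x \<bullet> e m"] by simp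
    ultimately have "p \<bullet> e m = x \<bullet> e m" by (rule sums_unique2)
    then show "(x - p) \<bullet> e m = 0" by (simp add: inner_diff_left)
  qed
  then have "T p = T x" by (simp add: T.diff)
  moreover have "(\<lambda>k. T (a k)) sums T p" using \<open>a sums p\<close> by (rule T.sums)
  then have "(\<lambda>M. \<Sum>m<M. T (a m)) \<longlonglongrightarrow> T p" by (simp add: sums_def)
  moreover have "(\<Sum>m<M. T (a m)) = (\<Sum>m\<in>A \<inter> {..<M}. (x \<bullet> e m) *\<^sub>R T (e m))" for M
    by (rule sum.mono_neutral_cong_right) (auto simp: a_def u_def T.scaleR T.zero)
  ultimately show ?thesis by simp
qed

section \<open>Approximation of tensor power operators\<close>

lemma bounded_linear_on_zero:
  assumes "bounded_linear_on V N T" "0 \<in> V"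
  shows "T 0 = 0"
proof -
  have "T (0 *\<^sub>R 0) = 0 *\<^sub>R T 0"
    using assms unfolding bounded_linear_on_def by blast
  then show ?thesis by simp
qed

lemma bounded_linear_on_sum:
  assumes T: "bounded_linear_on V N T" and V: "subspace V" and "finite I" and v: "\<And>i. i \<in> I \<Longrightarrow> v i \<in> V"
  shows "T (\<Sum>i\<in>I. c i *\<^sub>R v i) = (\<Sum>i\<in>I. c i *\<^sub>R T (v i))"
  using \<open>finite I\<close> v
proof (induction I)
  case empty
  show ?case using bounded_linear_on_zero[OF T] V by (simp add: subspace_0)
next
  case (insert i I)
  then have "c i *\<^sub>R v i \<in> V" "(\<Sum>i\<in>I. c i *\<^sub>R v i) \<in> V"
    using V by (auto intro!: subspace_sum subspace_scale)
  then have "T (c i *\<^sub>R v i + (\<Sum>i\<in>I. c i *\<^sub>R v i)) = T (c i *\<^sub>R v i) + T (\<Sum>i\<in>I. c i *\<^sub>R v i)"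
    using T unfolding bounded_linear_on_def by blast
  also have "T (c i *\<^sub>R v i) = c i *\<^sub>R T (v i)"
    using T insert.prems unfolding bounded_linear_on_def by blast
  finally show ?case using insert by simp
qed

lemma bounded_linear_on_norm_tendsto:
  assumes T: "bounded_linear_on V norm T" and V: "subspace V"
    and x: "\<And>n. x n \<in> V" "l \<in> V" and lim: "x \<longlonglongrightarrow> l"
  shows "(\<lambda>n. T (x n)) \<longlonglongrightarrow> T l"
proof -
  obtain K where K: "\<And>v. v \<in> V \<Longrightarrow> norm (T v) \<le> K * norm v"
    using T unfolding bounded_linear_on_def by blast
  have diff: "T (x n) - T l = T (x n - l)" for n
  proof -
    have "T ((x n - l) + l) = T (x n - l) + T l"
      using T x V unfolding bounded_linear_on_def by (meson subspace_diff)
    then show ?thesis by simp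
  qed
  have "(\<lambda>n. K * norm (x n - l)) \<longlonglongrightarrow> K * norm (l - l)"
    by (intro tendsto_intros lim)
  then have "(\<lambda>n. K * norm (x n - l)) \<longlonglongrightarrow> 0"
    by simp
  then have "(\<lambda>n. T (x n) - T l) \<longlonglongrightarrow> 0"
    by (rule Lim_null_comparison[rotated])
      (auto simp: diff intro!: always_eventually K subspace_diff V x)
  then show ?thesis by (simp add: LIM_zero_iff)
qed

lemma subspace_closure_span:
  fixes A :: "'a::real_normed_vector set"
  shows "subspace (closure (span A))"
proof (rule subspaceI)
  show "0 \<in> closure (span A)" using closure_subset span_zero by blast
  show "x + y \<in> closure (span A)" if x: "x \<in> closure (span A)" and y: "y \<in> closure (span A)" for x y
  proof -
    obtain f where "\<forall>n. f n \<in> span A" "f \<longlonglongrightarrow> x"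
      using x unfolding closure_sequential by blast
    moreover obtain g where "\<forall>n. g n \<in> span A" "g \<longlonglongrightarrow> y"
      using y unfolding closure_sequential by blast
    ultimately have "(\<lambda>n. f n + g n) \<longlonglongrightarrow> x + y" "\<And>n. f n + g n \<in> span A"
      by (auto intro: tendsto_add span_add)
    then show ?thesis unfolding closure_sequential by (intro exI[of _ "\<lambda>n. f n + g n"]) auto
  qed
  show "c *\<^sub>R x \<in> closure (span A)" if x: "x \<in> closure (span A)" for c x
  proof -
    obtain f where "\<forall>n. f n \<in> span A" "f \<longlonglongrightarrow> x"
      using x unfolding closure_sequential by blast
    then have "(\<lambda>n. c *\<^sub>R f n) \<longlonglongrightarrow> c *\<^sub>R x" "\<And>n. c *\<^sub>R f n \<in> span A"
      by (auto intro: tendsto_scaleR span_scale)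
    then show ?thesis unfolding closure_sequential by (intro exI[of _ "\<lambda>n. c *\<^sub>R f n"]) auto
  qed
qed

text \<open>Gaussian elimination: the last equation either is trivial on \<open>K\<close> or removes
  one unknown \<open>k0\<close>, leaving one equation and one unknown fewer.\<close>

lemma homogeneous_system_nontrivial_solution:
  fixes a :: "nat \<Rightarrow> 'i \<Rightarrow> real"
  assumes "finite K" "n < card K"
  shows "\<exists>c. (\<exists>k\<in>K. c k \<noteq> 0) \<and> (\<forall>j<n. (\<Sum>k\<in>K. c k * a j k) = 0)"
  using assms
proof (induction n arbitrary: K a)
  case 0
  then have "K \<noteq> {}" by auto
  then show ?case by (intro exI[of _ "\<lambda>_. 1"]) auto
next
  case (Suc n)
  show ?case
  proof (cases "\<exists>k0\<in>K. a n k0 \<noteq> 0")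
    case False
    obtain c where "\<exists>k\<in>K. c k \<noteq> 0" "\<forall>j<n. (\<Sum>k\<in>K. c k * a j k) = 0"
      using Suc.IH[of K a] Suc.prems by auto
    with False show ?thesis by (intro exI[of _ c]) (auto simp: less_Suc_eq)
  next
    case True
    then obtain k0 where k0: "k0 \<in> K" "a n k0 \<noteq> 0" by blast
    \<comment> \<open>These are the coefficients after equation \<open>n\<close> has been solved for
      the unknown \<open>k0\<close> and substituted into the others; \<open>b\<close> below restores
      the value at \<open>k0\<close>.\<close>
    define a' where "a' j k = a j k - a j k0 * a n k / a n k0" for j k
    have "n < card (K - {k0})" using Suc.prems k0 by simp
    then obtain c where c: "\<exists>k\<in>K - {k0}. c k \<noteq> 0"
      and c0: "\<And>j. j < n \<Longrightarrow> (\<Sum>k\<in>K - {k0}. c k * a' j k) = 0"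
      using Suc.IH[of "K - {k0}" a'] Suc.prems by blast
    define \<sigma> where "\<sigma> = (\<Sum>k\<in>K - {k0}. c k * a n k)"
    define b where "b k = (if k = k0 then - \<sigma> / a n k0 else c k)" for k
    have sum_b: "(\<Sum>k\<in>K. b k * a j k) = - \<sigma> / a n k0 * a j k0 + (\<Sum>k\<in>K - {k0}. c k * a j k)" for j
      using Suc.prems k0 by (subst sum.remove[of K k0]) (auto simp: b_def intro!: sum.cong)
    have "(\<Sum>k\<in>K. b k * a j k) = 0" if "j < Suc n" for j
    proof (cases "j = n")
      case True
      then show ?thesis using k0 by (simp add: sum_b \<sigma>_def)
    next
      case False
      have "0 = (\<Sum>k\<in>K - {k0}. c k * a' j k)" using c0[of j] False that by simp
      also have "\<dots> = (\<Sum>k\<in>K - {k0}. c k * a j k) - (\<Sum>k\<in>K - {k0}. c k * a n k) * a j k0 / a n k0"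
        unfolding sum_distrib_right sum_divide_distrib sum_subtractf[symmetric]
        by (intro sum.cong) (auto simp: a'_def algebra_simps)
      finally show ?thesis by (simp add: sum_b \<sigma>_def)
    qed
    moreover have "\<exists>k\<in>K. b k \<noteq> 0" using c by (auto simp: b_def)
    ultimately show ?thesis by blast
  qed
qed

section \<open>Singular tensors and the expansion of the tensor power operator\<close>

locale tensor_singular_system =
  fixes d :: nat
    and S1 :: "'a::{real_inner, complete_space} \<Rightarrow> 'b::{real_inner, complete_space}"
    and A :: "nat set" and e :: "nat \<Rightarrow> 'a" and lam :: "nat \<Rightarrow> real"
    and tH :: "(nat \<Rightarrow> 'a) \<Rightarrow> 'h::{real_inner, complete_space}" and H :: "'h set"
    and tG :: "(nat \<Rightarrow> 'b) \<Rightarrow> 'g::{real_inner, complete_space}" and G :: "'g set"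
    and S :: "'h \<Rightarrow> 'g"
  assumes e_inner: "\<And>m n. m \<in> A \<Longrightarrow> n \<in> A \<Longrightarrow> e m \<bullet> e n = (if m = n then 1 else 0)"
    and S1_inner: "\<And>m n. m \<in> A \<Longrightarrow> n \<in> A \<Longrightarrow> S1 (e m) \<bullet> S1 (e n) = (if m = n then lam m else 0)"
    and S1_expansion: "\<And>x. (\<lambda>M. \<Sum>m\<in>A \<inter> {..<M}. (x \<bullet> e m) *\<^sub>R S1 (e m)) \<longlonglongrightarrow> S1 x"
    and lam_pos: "\<And>m. m \<in> A \<Longrightarrow> lam m > 0"
    and tH: "hilbert_tensor_power d tH H"
    and tG: "hilbert_tensor_power d tG G"
    and S: "tensor_power_operator tH H tG S1 S"
begin

text \<open>\<open>E\<close> lists the right singular tensors, \<open>F\<close> the left ones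
  without normalisation, so that \<open>S\<close> maps \<open>E i\<close> to \<open>F i\<close>, and
  \<open>w\<close> the squared singular values. Index tuples are taken from \<open>PiE\<close>,
  whose extensionality makes tuples equal as soon as they agree below \<open>d\<close>.\<close>

definition E :: "(nat \<Rightarrow> nat) \<Rightarrow> 'h" where "E i = tH (\<lambda>j. e (i j))"
definition F :: "(nat \<Rightarrow> nat) \<Rightarrow> 'g" where "F i = tG (\<lambda>j. S1 (e (i j)))"
definition w :: "(nat \<Rightarrow> nat) \<Rightarrow> real" where "w i = (\<Prod>j<d. lam (i j))"

lemma tH_inner: "tH x \<bullet> tH y = (\<Prod>j<d. x j \<bullet> y j)"
  using tH by (simp add: hilbert_tensor_power_def)

lemma tG_inner: "tG x \<bullet> tG y = (\<Prod>j<d. x j \<bullet> y j)"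
  using tG by (simp add: hilbert_tensor_power_def)

lemma H_eq: "H = closure (span (range tH))" and G_eq: "G = closure (span (range tG))"
  using tH tG by (simp_all add: hilbert_tensor_power_def)

lemma span_subset_H: "span (range tH) \<subseteq> H"
  unfolding H_eq by (rule closure_subset)

lemma subspace_H: "subspace H"
  unfolding H_eq by (rule subspace_closure_span)

lemma E_in_H: "E i \<in> H"
  unfolding E_def by (rule subsetD[OF span_subset_H span_base[OF rangeI]])

lemma F_in_G: "F i \<in> G"
  unfolding F_def G_eq by (rule subsetD[OF closure_subset span_base[OF rangeI]])

lemma S_bounded_linear: "bounded_linear_on H norm S" and S_tH: "S (tH x) = tG (\<lambda>j. S1 (x j))"
  using S by (simp_all add: tensor_power_operator_def)

lemma S_E: "S (E i) = F i"
  by (simp add: E_def F_def S_tH)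

lemma PiE_eq_iff: "i = i' \<longleftrightarrow> (\<forall>j<d. i j = i' j)" if "i \<in> PiE {..<d} (\<lambda>_. A)" "i' \<in> PiE {..<d} (\<lambda>_. A)"
proof
  assume "\<forall>j<d. i j = i' j"
  then show "i = i'" by (intro PiE_ext[OF that]) simp
qed simp

lemma E_inner: "E i \<bullet> E i' = (if i = i' then 1 else 0)"
  if "i \<in> PiE {..<d} (\<lambda>_. A)" "i' \<in> PiE {..<d} (\<lambda>_. A)"
proof -
  have "E i \<bullet> E i' = (\<Prod>j<d. if i j = i' j then 1 else 0)"
    unfolding E_def tH_inner by (rule prod.cong[OF refl], rule e_inner) (rule PiE_mem[OF that(1)] PiE_mem[OF that(2)], assumption)+
  also have "\<dots> = (if i = i' then 1 else 0)"
    using PiE_eq_iff[OF that] by (auto simp: prod_zero_iff)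
  finally show ?thesis .
qed

lemma F_inner: "F i \<bullet> F i' = (if i = i' then w i else 0)"
  if "i \<in> PiE {..<d} (\<lambda>_. A)" "i' \<in> PiE {..<d} (\<lambda>_. A)"
proof -
  have "F i \<bullet> F i' = (\<Prod>j<d. if i j = i' j then lam (i j) else 0)"
    unfolding F_def tG_inner by (rule prod.cong[OF refl], rule S1_inner) (rule PiE_mem[OF that(1)] PiE_mem[OF that(2)], assumption)+
  also have "\<dots> = (if i = i' then w i else 0)"
    using PiE_eq_iff[OF that] by (auto simp: prod_zero_iff w_def)
  finally show ?thesis .
qed

lemma norm_sum_F:
  assumes "finite J" "J \<subseteq> PiE {..<d} (\<lambda>_. A)"
  shows "(norm (\<Sum>i\<in>J. c i *\<^sub>R F i))\<^sup>2 = (\<Sum>i\<in>J. (c i)\<^sup>2 * w i)"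
  using assms(1) by (rule norm_sum_orthogonal) (intro F_inner subsetD[OF assms(2)])

lemma norm_sum_E:
  assumes "finite J" "J \<subseteq> PiE {..<d} (\<lambda>_. A)"
  shows "(norm (\<Sum>i\<in>J. c i *\<^sub>R E i))\<^sup>2 = (\<Sum>i\<in>J. (c i)\<^sup>2)"
proof -
  have "(norm (\<Sum>i\<in>J. c i *\<^sub>R E i))\<^sup>2 = (\<Sum>i\<in>J. (c i)\<^sup>2 * 1)"
    using assms(1) by (rule norm_sum_orthogonal) (intro E_inner subsetD[OF assms(2)])
  then show ?thesis by simp
qed

lemma bessel_E:
  assumes "finite J" "J \<subseteq> PiE {..<d} (\<lambda>_. A)"
  shows "(\<Sum>i\<in>J. (f \<bullet> E i)\<^sup>2) \<le> (norm f)\<^sup>2"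
  using assms(1) by (rule bessel_inequality) (intro E_inner subsetD[OF assms(2)])

abbreviation box :: "nat \<Rightarrow> (nat \<Rightarrow> nat) set" where
  "box M \<equiv> PiE {..<d} (\<lambda>_. A \<inter> {..<M})"

lemma finite_box: "finite (box M)"
  by (rule finite_PiE) simp_all

lemma box_subset: "box M \<subseteq> PiE {..<d} (\<lambda>_. A)"
  by (rule PiE_mono, rule Int_lower1)

text \<open>The truncated tensor and its expansion are shown equal by expanding the squared distance,
  so that multilinearity of \<open>tG\<close> is not needed.\<close>

lemma tG_truncation:
  "(\<Sum>i\<in>box M. (tH x \<bullet> E i) *\<^sub>R F i) = tG (\<lambda>j. \<Sum>m\<in>A \<inter> {..<M}. (x j \<bullet> e m) *\<^sub>R S1 (e m))"
  (is "?s = tG ?y")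
proof -
  define c where "c i = (\<Prod>j<d. x j \<bullet> e (i j))" for i
  \<comment> \<open>\<open>P\<close> is the common value of all three inner products formed from the
    two sides, so their squared distance is P - 2P + P = 0.\<close>
  define P where "P = (\<Prod>j<d. \<Sum>m\<in>A \<inter> {..<M}. (x j \<bullet> e m)\<^sup>2 * lam m)"
  have s: "?s = (\<Sum>i\<in>box M. c i *\<^sub>R F i)" by (simp add: c_def E_def tH_inner)
  have P: "P = (\<Sum>i\<in>box M. (c i)\<^sup>2 * w i)"
    unfolding P_def by (subst prod_sum_PiE)
      (auto simp: c_def w_def prod.distrib prod_power_distrib)
  have ss: "?s \<bullet> ?s = P"
    unfolding P s power2_norm_eq_inner[symmetric]
    by (rule norm_sum_F[OF finite_box box_subset])
  have yS: "?y j \<bullet> S1 (e m) = (x j \<bullet> e m) * lam m" if "m \<in> A \<inter> {..<M}" for j m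
  proof -
    have "?y j \<bullet> S1 (e m) = (\<Sum>k\<in>A \<inter> {..<M}. if k = m then (x j \<bullet> e m) * lam m else 0)"
      unfolding inner_sum_left by (intro sum.cong) (use that in \<open>auto simp: S1_inner\<close>)
    then show ?thesis using that by simp
  qed
  have "tG ?y \<bullet> ?s = (\<Sum>i\<in>box M. c i * (\<Prod>j<d. ?y j \<bullet> S1 (e (i j))))"
    unfolding s by (simp add: inner_sum_right F_def tG_inner)
  also have "\<dots> = (\<Sum>i\<in>box M. c i * (\<Prod>j<d. (x j \<bullet> e (i j)) * lam (i j)))"
    by (intro sum.cong arg_cong2[where f = times] prod.cong refl yS) auto
  also have "\<dots> = P" by (simp add: P c_def w_def prod.distrib power2_eq_square mult.assoc)
  finally have ys: "tG ?y \<bullet> ?s = P" .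
  have "tG ?y \<bullet> tG ?y = P"
    unfolding tG_inner P_def
    by (intro prod.cong refl norm_sum_orthogonal[unfolded power2_norm_eq_inner]) (auto simp: S1_inner)
  with ss ys have "(?s - tG ?y) \<bullet> (?s - tG ?y) = 0"
    by (simp add: inner_diff_left inner_diff_right inner_commute)
  then show ?thesis by simp
qed

text \<open>Continuity comes from the inner product formula alone: the squared distance is a
  combination of three finite products of inner products, each of which converges.\<close>

lemma tG_tendsto:
  assumes "\<And>j. j < d \<Longrightarrow> (\<lambda>n. y n j) \<longlonglongrightarrow> z j"
  shows "(\<lambda>n. tG (y n)) \<longlonglongrightarrow> tG z"
proof -
  have "(\<lambda>n. (norm (tG (y n) - tG z))\<^sup>2) \<longlonglongrightarrow> tG z \<bullet> tG z - 2 * (tG z \<bullet> tG z) + tG z \<bullet> tG z"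
  proof -
    have eq: "(norm (tG (y n) - tG z))\<^sup>2
        = tG (y n) \<bullet> tG (y n) - 2 * (tG (y n) \<bullet> tG z) + tG z \<bullet> tG z" for n
      by (simp add: power2_norm_eq_inner inner_diff_left inner_diff_right inner_commute[of "tG z" "tG (y n)"])
    show ?thesis
      unfolding eq tG_inner by (intro tendsto_intros assms) auto
  qed
  then have "(\<lambda>n. norm (tG (y n) - tG z)) \<longlonglongrightarrow> 0" by simp
  then show ?thesis using LIM_zero_cancel tendsto_norm_zero_iff by blast
qed

text \<open>For an elementary tensor the partial sum over \<open>box M\<close> is the tensor of the
  truncated factors, and continuity of \<open>tG\<close> applies. Both sides are linear in
  \<open>f\<close>, which gives the span.\<close>

lemma S_expansion_span:
  assumes "f \<in> span (range tH)"
  shows "(\<lambda>M. \<Sum>i\<in>box M. (f \<bullet> E i) *\<^sub>R F i) \<longlonglongrightarrow> S f"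
proof -
  \<comment> \<open>Membership in \<open>H\<close> is carried through the induction because
    \<open>S\<close> is additive only there.\<close>
  have "f \<in> H \<and> (\<lambda>M. \<Sum>i\<in>box M. (f \<bullet> E i) *\<^sub>R F i) \<longlonglongrightarrow> S f"
    using assms
  proof (induction rule: span_induct_alt)
    case base
    show ?case using bounded_linear_on_zero[OF S_bounded_linear] subspace_H by (simp add: subspace_0)
  next
    case (step c x y)
    obtain u where u: "x = tH u" using step by blast
    have "(\<lambda>M. \<Sum>i\<in>box M. (x \<bullet> E i) *\<^sub>R F i) \<longlonglongrightarrow> S x"
      unfolding u tG_truncation S_tH by (intro tG_tendsto S1_expansion)
    then have "(\<lambda>M. c *\<^sub>R (\<Sum>i\<in>box M. (x \<bullet> E i) *\<^sub>R F i) + (\<Sum>i\<in>box M. (y \<bullet> E i) *\<^sub>R F i))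
        \<longlonglongrightarrow> c *\<^sub>R S x + S y"
      using step by (intro tendsto_intros) auto
    moreover have x: "x \<in> H" and "y \<in> H"
      using step span_subset_H by (auto intro: span_base)
    moreover from x have "c *\<^sub>R x \<in> H"
      using subspace_H by (rule subspace_scale[rotated])
    moreover from calculation have "S (c *\<^sub>R x + y) = c *\<^sub>R S x + S y"
      using S_bounded_linear unfolding bounded_linear_on_def by simp
    ultimately show ?case
      using subspace_H by (simp add: subspace_add inner_add_left scaleR_sum_right sum.distrib scaleR_add_left)
  qed
  then show ?thesis ..
qed

text \<open>On the span, the tail outside \<open>K\<close> has squared norm equal to the limit of
  sums of (f . E i)^2 w i, which Bessel's inequality bounds by c |f|^2. The inequality passes to the
  closure \<open>H\<close> because both sides are continuous.\<close>

lemma S_approximation_error: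
  assumes K: "finite K" "K \<subseteq> PiE {..<d} (\<lambda>_. A)"
    and c: "\<And>i. i \<in> PiE {..<d} (\<lambda>_. A) - K \<Longrightarrow> w i \<le> c" "0 \<le> c"
    and "f \<in> H"
  shows "norm (S f - (\<Sum>i\<in>K. (f \<bullet> E i) *\<^sub>R F i)) \<le> sqrt c * norm f"
proof -
  define R where "R f = S f - (\<Sum>i\<in>K. (f \<bullet> E i) *\<^sub>R F i)" for f
  have on_span: "norm (R g) \<le> sqrt c * norm g" if "g \<in> span (range tH)" for g
  proof -
    have "finite (\<Union>i\<in>K. i ` {..<d})" using K(1) by simp
    then obtain M0 where "\<forall>m\<in>(\<Union>i\<in>K. i ` {..<d}). m < M0"
      unfolding finite_nat_set_iff_bounded ..
    then have M0: "i j < M0" if "i \<in> K" "j < d" for i j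
      using that by simp
    have "norm ((\<Sum>i\<in>box M. (g \<bullet> E i) *\<^sub>R F i) - (\<Sum>i\<in>K. (g \<bullet> E i) *\<^sub>R F i)) \<le> sqrt c * norm g"
      if "M \<ge> M0" for M
    proof -
      have "i \<in> box M" if "i \<in> K" for i
      proof (rule PiE_I)
        have i: "i \<in> PiE {..<d} (\<lambda>_. A)" using K(2) that by blast
        show "i j \<in> A \<inter> {..<M}" if "j \<in> {..<d}" for j
          using PiE_mem[OF i that] M0[OF \<open>i \<in> K\<close>, of j] that \<open>M \<ge> M0\<close> by simp
        show "i j = undefined" if "j \<notin> {..<d}" for j
          using i that by (rule PiE_arb)
      qed
      then have "K \<subseteq> box M" by (rule subsetI)
      then have "(\<Sum>i\<in>box M. (g \<bullet> E i) *\<^sub>R F i) - (\<Sum>i\<in>K. (g \<bullet> E i) *\<^sub>R F i)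
          = (\<Sum>i\<in>box M - K. (g \<bullet> E i) *\<^sub>R F i)"
        by (simp add: sum_diff finite_box)
      also have "(norm \<dots>)\<^sup>2 = (\<Sum>i\<in>box M - K. (g \<bullet> E i)\<^sup>2 * w i)"
        by (rule norm_sum_F) (use box_subset finite_box in auto)
      also have "\<dots> \<le> (\<Sum>i\<in>box M - K. (g \<bullet> E i)\<^sup>2 * c)"
        by (intro sum_mono mult_left_mono c(1)) (use box_subset in auto)
      also have "\<dots> = c * (\<Sum>i\<in>box M - K. (g \<bullet> E i)\<^sup>2)"
        by (simp add: sum_distrib_left mult.commute)
      also have "\<dots> \<le> c * (norm g)\<^sup>2"
        by (intro mult_left_mono bessel_E c(2)) (use box_subset finite_box in auto)
      finally show ?thesis
        using real_le_rsqrt by (fastforce simp: real_sqrt_mult)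
    qed
    then have "\<forall>\<^sub>F M in sequentially.
        norm ((\<Sum>i\<in>box M. (g \<bullet> E i) *\<^sub>R F i) - (\<Sum>i\<in>K. (g \<bullet> E i) *\<^sub>R F i)) \<le> sqrt c * norm g"
      unfolding eventually_sequentially by blast
    moreover have "(\<lambda>M. norm ((\<Sum>i\<in>box M. (g \<bullet> E i) *\<^sub>R F i) - (\<Sum>i\<in>K. (g \<bullet> E i) *\<^sub>R F i)))
        \<longlonglongrightarrow> norm (R g)"
      unfolding R_def by (intro tendsto_intros S_expansion_span that)
    ultimately show ?thesis by (intro tendsto_upperbound) auto
  qed
  obtain g where g: "\<And>n. g n \<in> span (range tH)" "g \<longlonglongrightarrow> f"
    using \<open>f \<in> H\<close> unfolding H_eq closure_sequential by blast
  have "(\<lambda>n. S (g n)) \<longlonglongrightarrow> S f"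
    using g span_subset_H \<open>f \<in> H\<close>
    by (intro bounded_linear_on_norm_tendsto[OF S_bounded_linear subspace_H]) auto
  then have "(\<lambda>n. norm (R (g n))) \<longlonglongrightarrow> norm (R f)"
    unfolding R_def by (intro tendsto_intros g(2))
  moreover have "(\<lambda>n. sqrt c * norm (g n)) \<longlonglongrightarrow> sqrt c * norm f"
    by (intro tendsto_intros g(2))
  ultimately have "norm (R f) \<le> sqrt c * norm f"
    by (rule LIMSEQ_le) (use on_span g(1) in blast)
  then show ?thesis by (simp add: R_def)
qed

section \<open>Worst case errors of the scaled problem\<close>

context
  fixes s :: real
  assumes s_pos: "s > 0"
begin

lemma ip_norm_scaled: "ip_norm (scaled_inner s) (f :: 'h) = norm f / sqrt s"
  using s_pos by (simp add: ip_norm_def scaled_inner_def norm_eq_sqrt_inner real_sqrt_divide)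

lemma scaled_unit_ball: "{f \<in> H. ip_norm (scaled_inner s) f \<le> 1} = {f \<in> H. norm f \<le> sqrt s}"
  using s_pos by (simp add: ip_norm_scaled)

text \<open>Real suprema carry information only over sets bounded above. The two introduction rules
  below rely on this for every algorithm that enters the infimum.\<close>

lemma bdd_above_algorithm_error:
  assumes "Q \<in> linear_algorithms H (scaled_inner s) G n"
  shows "bdd_above ((\<lambda>f. norm (S f - Q f)) ` {f \<in> H. norm f \<le> sqrt s})"
proof -
  obtain L g where L: "\<And>j. j < n \<Longrightarrow> bounded_linear_on H (ip_norm (scaled_inner s)) (L j)"
    and Q: "Q = (\<lambda>f. \<Sum>j<n. L j f *\<^sub>R (g j :: 'g))"
    using assms unfolding linear_algorithms_def by blast
  obtain K where K: "\<And>f. f \<in> H \<Longrightarrow> norm (S f) \<le> K * norm f"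
    using S_bounded_linear unfolding bounded_linear_on_def by blast
  have "\<exists>C. \<forall>f\<in>H. norm f \<le> sqrt s \<longrightarrow> \<bar>L j f\<bar> \<le> C" if j: "j < n" for j
  proof -
    obtain C where C: "\<And>f. f \<in> H \<Longrightarrow> norm (L j f) \<le> C * ip_norm (scaled_inner s) f"
      using L[OF j] unfolding bounded_linear_on_def by blast
    have "\<bar>L j f\<bar> \<le> \<bar>C\<bar>" if "f \<in> H" "norm f \<le> sqrt s" for f
    proof -
      have "C * (norm f / sqrt s) \<le> \<bar>C\<bar> * 1"
        using that(2) s_pos by (intro mult_mono) auto
      then show ?thesis using C[OF that(1)] by (simp add: ip_norm_scaled)
    qed
    then show ?thesis by blast
  qed
  then obtain C where C: "\<And>j f. j < n \<Longrightarrow> f \<in> H \<Longrightarrow> norm f \<le> sqrt s \<Longrightarrow> \<bar>L j f\<bar> \<le> C j" by metis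
  show ?thesis
  proof (rule bdd_aboveI2)
    fix f assume "f \<in> {f \<in> H. norm f \<le> sqrt s}"
    then have f: "f \<in> H" "norm f \<le> sqrt s" by auto
    have "norm (S f) \<le> \<bar>K\<bar> * sqrt s"
      using K[OF f(1)] mult_mono[OF abs_ge_self f(2), of K] by simp
    moreover have "norm (Q f) \<le> (\<Sum>j<n. C j * norm (g j))"
      unfolding Q by (intro sum_norm_le) (use C f in \<open>auto intro!: mult_right_mono\<close>)
    moreover have "norm (S f - Q f) \<le> norm (S f) + norm (Q f)" by (rule norm_triangle_ineq4)
    ultimately show "norm (S f - Q f) \<le> \<bar>K\<bar> * sqrt s + (\<Sum>j<n. C j * norm (g j))" by linarith
  qed
qed

lemma worst_case_error_leI:
  assumes "Q \<in> linear_algorithms H (scaled_inner s) G n"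
    and "\<And>f. f \<in> H \<Longrightarrow> norm f \<le> sqrt s \<Longrightarrow> norm (S f - Q f) \<le> b"
  shows "worst_case_error H (scaled_inner s) G S n \<le> b"
  unfolding worst_case_error_def scaled_unit_ball
proof (rule cINF_lower2)
  have zero: "0 \<in> {f \<in> H. norm f \<le> sqrt s}" using subspace_H s_pos by (simp add: subspace_0)
  show "(SUP f\<in>{f \<in> H. norm f \<le> sqrt s}. norm (S f - Q f)) \<le> b"
    by (rule cSUP_least) (use zero assms(2) in auto)
  show "bdd_below ((\<lambda>Q. SUP f\<in>{f \<in> H. norm f \<le> sqrt s}. norm (S f - Q f)) `
      linear_algorithms H (scaled_inner s) G n)"
  proof (rule bdd_belowI2)
    fix Q assume "Q \<in> linear_algorithms H (scaled_inner s) G n"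
    then show "0 \<le> (SUP f\<in>{f \<in> H. norm f \<le> sqrt s}. norm (S f - Q f))"
      by (rule cSUP_upper2[OF bdd_above_algorithm_error zero norm_ge_zero])
  qed
qed (rule assms(1))

lemma worst_case_error_geI:
  assumes "\<And>Q. Q \<in> linear_algorithms H (scaled_inner s) G n \<Longrightarrow>
      \<exists>f\<in>H. norm f \<le> sqrt s \<and> b \<le> norm (S f - Q f)"
  shows "b \<le> worst_case_error H (scaled_inner s) G S n"
  unfolding worst_case_error_def scaled_unit_ball
proof (rule cINF_greatest)
  have "(\<lambda>f. \<Sum>j<n. 0 *\<^sub>R (0 :: 'g)) \<in> linear_algorithms H (scaled_inner s) G n"
  proof -
    have "0 \<in> G" unfolding G_eq using subspace_closure_span subspace_0 by blast
    moreover have "bounded_linear_on H (ip_norm (scaled_inner s)) (\<lambda>_. 0 :: real)"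
      unfolding bounded_linear_on_def by (auto intro: exI[of _ 0])
    ultimately show ?thesis
      unfolding linear_algorithms_def by (intro CollectI exI[of _ "\<lambda>_ _. 0"] exI[of _ "\<lambda>_. 0"]) auto
  qed
  then show "linear_algorithms H (scaled_inner s) G n \<noteq> {}" by blast
next
  fix Q assume Q: "Q \<in> linear_algorithms H (scaled_inner s) G n"
  then obtain f where f: "f \<in> {f \<in> H. norm f \<le> sqrt s}" "b \<le> norm (S f - Q f)" using assms by blast
  show "b \<le> (SUP f\<in>{f \<in> H. norm f \<le> sqrt s}. norm (S f - Q f))"
    by (rule cSUP_upper2[OF bdd_above_algorithm_error[OF Q] f])
qed

text \<open>The algorithm truncates the singular expansion to \<open>K\<close>, spending one
  functional and one target element per tuple. The scaled unit ball is the ordinary ball of radius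
  \<open>sqrt s\<close>, whence the factor \<open>s\<close> under the root.\<close>

lemma worst_case_error_upper:
  assumes K: "finite K" "K \<subseteq> PiE {..<d} (\<lambda>_. A)"
    and c: "\<And>i. i \<in> PiE {..<d} (\<lambda>_. A) - K \<Longrightarrow> w i \<le> c" "0 \<le> c"
  shows "worst_case_error H (scaled_inner s) G S (card K) \<le> sqrt (s * c)"
proof -
  obtain h where h: "bij_betw h {..<card K} K"
    using ex_bij_betw_nat_finite[OF K(1)] by (auto simp: atLeast0LessThan)
  define Q where "Q f = (\<Sum>j<card K. (f \<bullet> E (h j)) *\<^sub>R F (h j))" for f
  have "bounded_linear_on H (ip_norm (scaled_inner s)) (\<lambda>f. f \<bullet> E i)" for i
  proof -
    have "norm (f \<bullet> E i) \<le> (norm (E i) * sqrt s) * ip_norm (scaled_inner s) f" for f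
      using Cauchy_Schwarz_ineq2[of f "E i"] s_pos by (simp add: ip_norm_scaled mult.commute)
    then show ?thesis unfolding bounded_linear_on_def by (auto simp: inner_add_left)
  qed
  then have Q: "Q \<in> linear_algorithms H (scaled_inner s) G (card K)"
    unfolding linear_algorithms_def Q_def
    by (intro CollectI exI[of _ "\<lambda>j f. f \<bullet> E (h j)"] exI[of _ "\<lambda>j. F (h j)"]) (auto simp: F_in_G)
  have Q_eq: "Q f = (\<Sum>i\<in>K. (f \<bullet> E i) *\<^sub>R F i)" for f
    unfolding Q_def by (rule sum.reindex_bij_betw[OF h])
  show ?thesis
  proof (rule worst_case_error_leI[OF Q])
    fix f assume f: "f \<in> H" "norm f \<le> sqrt s"
    have "norm (S f - Q f) \<le> sqrt c * norm f"
      unfolding Q_eq by (rule S_approximation_error[OF K c f(1)])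
    also have "\<dots> \<le> sqrt c * sqrt s" using f(2) c(2) by (intro mult_left_mono) auto
    finally show "norm (S f - Q f) \<le> sqrt (s * c)" by (simp add: real_sqrt_mult mult.commute)
  qed
qed

text \<open>A linear combination of more than \<open>n\<close> singular tensors can be chosen in the kernel of the
  \<open>n\<close> functionals of a given algorithm, which then returns \<open>0\<close>.\<close>

lemma worst_case_error_lower:
  assumes K: "finite K" "K \<subseteq> PiE {..<d} (\<lambda>_. A)" "n < card K"
    and c: "\<And>i. i \<in> K \<Longrightarrow> c \<le> w i" "0 \<le> c"
  shows "sqrt (s * c) \<le> worst_case_error H (scaled_inner s) G S n"
proof (rule worst_case_error_geI)
  fix Q assume "Q \<in> linear_algorithms H (scaled_inner s) G n"
  then obtain L g where L: "\<And>j. j < n \<Longrightarrow> bounded_linear_on H (ip_norm (scaled_inner s)) (L j)"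
    and Q: "Q = (\<lambda>f. \<Sum>j<n. L j f *\<^sub>R (g j :: 'g))"
    unfolding linear_algorithms_def by blast
  obtain b where b: "\<exists>i\<in>K. b i \<noteq> 0" and b0: "\<And>j. j < n \<Longrightarrow> (\<Sum>i\<in>K. b i * L j (E i)) = 0"
    using homogeneous_system_nontrivial_solution[OF K(1,3), of "\<lambda>j i. L j (E i)"] by blast
  define N where "N = sqrt (\<Sum>i\<in>K. (b i)\<^sup>2)"
  have "(\<Sum>i\<in>K. (b i)\<^sup>2) > 0"
    using b K(1) by (auto intro!: sum_pos2)
  then have N: "N > 0" "N\<^sup>2 = (\<Sum>i\<in>K. (b i)\<^sup>2)" by (simp_all add: N_def)
  \<comment> \<open>The rescaling puts \<open>f\<close> on the boundary of the scaled unit ball,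
    where its norm is \<open>sqrt s\<close>.\<close>
  define a where "a i = sqrt s / N * b i" for i
  have a2: "(\<Sum>i\<in>K. (a i)\<^sup>2) = s"
  proof -
    have "(\<Sum>i\<in>K. (a i)\<^sup>2) = (sqrt s / N)\<^sup>2 * (\<Sum>i\<in>K. (b i)\<^sup>2)"
      unfolding a_def power_mult_distrib sum_distrib_left ..
    also have "\<dots> = s" using N s_pos by (simp add: power_divide N(2)[symmetric])
    finally show ?thesis .
  qed
  define f where "f = (\<Sum>i\<in>K. a i *\<^sub>R E i)"
  have "f \<in> H"
    unfolding f_def using subspace_H E_in_H by (intro subspace_sum subspace_scale)
  have "(norm f)\<^sup>2 = s" unfolding f_def by (simp add: norm_sum_E K a2)
  then have norm_f: "norm f = sqrt s" by (metis norm_ge_zero real_sqrt_unique)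
  have "L j f = 0" if "j < n" for j
  proof -
    have "L j f = (\<Sum>i\<in>K. a i *\<^sub>R L j (E i))"
      unfolding f_def by (rule bounded_linear_on_sum[OF L[OF that] subspace_H K(1) E_in_H])
    also have "\<dots> = sqrt s / N * (\<Sum>i\<in>K. b i * L j (E i))"
      by (simp add: a_def sum_distrib_left mult.assoc)
    finally show ?thesis using b0[OF that] by simp
  qed
  then have "Q f = 0" by (simp add: Q)
  have "S f = (\<Sum>i\<in>K. a i *\<^sub>R F i)"
    unfolding f_def by (subst bounded_linear_on_sum[OF S_bounded_linear subspace_H K(1) E_in_H]) (simp add: S_E)
  then have "(norm (S f))\<^sup>2 = (\<Sum>i\<in>K. (a i)\<^sup>2 * w i)" by (simp add: norm_sum_F K)
  moreover have "\<dots> \<ge> (\<Sum>i\<in>K. (a i)\<^sup>2 * c)" by (intro sum_mono mult_left_mono c) auto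
  then have "s * c \<le> (\<Sum>i\<in>K. (a i)\<^sup>2 * w i)" by (simp add: sum_distrib_right[symmetric] a2)
  ultimately have "sqrt (s * c) \<le> norm (S f)" by (simp add: real_le_lsqrt)
  then show "\<exists>f\<in>H. norm f \<le> sqrt s \<and> sqrt (s * c) \<le> norm (S f - Q f)"
    using \<open>f \<in> H\<close> norm_f \<open>Q f = 0\<close> by (intro bexI[of _ f]) auto
qed

text \<open>The constant tuple 1 has the largest weight, \<open>lam 1 ^ d\<close>, and fixes the
  initial error. Tuples exactly on the threshold may be left out because the error criterion is
  \<open>\<le>\<close>; hence the strict inequality in the counted set.\<close>

lemma normalized_complexity_eq_card:
  assumes "1 \<in> A" and lam_le: "\<And>m. m \<in> A \<Longrightarrow> lam m \<le> lam 1" and "\<epsilon> > 0"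
    and fin: "finite {i \<in> PiE {..<d} (\<lambda>_. A). \<epsilon>\<^sup>2 * lam 1 ^ d < w i}"
  shows "(LEAST n. worst_case_error H (scaled_inner s) G S n
            \<le> \<epsilon> * worst_case_error H (scaled_inner s) G S 0)
       = card {i \<in> PiE {..<d} (\<lambda>_. A). \<epsilon>\<^sup>2 * lam 1 ^ d < w i}"
    (is "_ = card ?K")
proof -
  have lam1: "lam 1 > 0" using \<open>1 \<in> A\<close> by (rule lam_pos)
  have K: "?K \<subseteq> PiE {..<d} (\<lambda>_. A)" by blast
  have init: "worst_case_error H (scaled_inner s) G S 0 = sqrt (s * lam 1 ^ d)"
  proof (rule antisym)
    have "w i \<le> lam 1 ^ d" if "i \<in> PiE {..<d} (\<lambda>_. A)" for i
    proof -
      have "w i \<le> (\<Prod>j<d. lam 1)"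
        unfolding w_def using that lam_pos lam_le
        by (intro prod_mono conjI) (auto intro: less_imp_le dest: PiE_mem)
      then show ?thesis by simp
    qed
    then show "worst_case_error H (scaled_inner s) G S 0 \<le> sqrt (s * lam 1 ^ d)"
      using worst_case_error_upper[of "{}" "lam 1 ^ d"] lam1 by simp
    define i where "i = (\<lambda>j\<in>{..<d}. 1::nat)"
    have "i \<in> PiE {..<d} (\<lambda>_. A)" using \<open>1 \<in> A\<close> by (auto simp: i_def)
    moreover have "w i = lam 1 ^ d" by (simp add: w_def i_def)
    ultimately show "sqrt (s * lam 1 ^ d) \<le> worst_case_error H (scaled_inner s) G S 0"
      using worst_case_error_lower[of "{i}" 0 "lam 1 ^ d"] lam1 by simp
  qed
  have thr: "\<epsilon> * sqrt (s * lam 1 ^ d) = sqrt (s * (\<epsilon>\<^sup>2 * lam 1 ^ d))"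
    using \<open>\<epsilon> > 0\<close> by (simp add: real_sqrt_mult)
  show ?thesis
    unfolding init thr
  proof (rule Least_equality)
    show "worst_case_error H (scaled_inner s) G S (card ?K) \<le> sqrt (s * (\<epsilon>\<^sup>2 * lam 1 ^ d))"
    proof (rule worst_case_error_upper[OF fin K])
      show "w i \<le> \<epsilon>\<^sup>2 * lam 1 ^ d" if "i \<in> PiE {..<d} (\<lambda>_. A) - ?K" for i
        using that by (metis (mono_tags, lifting) DiffE mem_Collect_eq not_le)
    qed (use lam1 in simp)
    fix n assume n: "worst_case_error H (scaled_inner s) G S n \<le> sqrt (s * (\<epsilon>\<^sup>2 * lam 1 ^ d))"
    show "card ?K \<le> n"
    proof (rule ccontr)
      assume "\<not> card ?K \<le> n"
      then have "n < card ?K" by simp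
      then have "?K \<noteq> {}" by (metis card.empty not_less_zero)
      \<comment> \<open>Finiteness leaves a gap: the least counted weight is still strictly above
        the threshold, so fewer functionals miss the criterion strictly.\<close>
      define c where "c = Min (w ` ?K)"
      have "c \<in> w ` ?K" unfolding c_def using fin \<open>?K \<noteq> {}\<close> by (intro Min_in) auto
      then have "\<epsilon>\<^sup>2 * lam 1 ^ d < c" by auto
      moreover have "0 \<le> \<epsilon>\<^sup>2 * lam 1 ^ d" using lam1 by simp
      moreover have "sqrt (s * c) \<le> worst_case_error H (scaled_inner s) G S n"
        using calculation fin by (intro worst_case_error_lower[OF fin K \<open>n < card ?K\<close>]) (auto simp: c_def)
      ultimately show False using n s_pos
        by (smt (verit) mult_less_cancel_left_pos real_sqrt_less_iff)
    qed
  qed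
qed

end

end

section \<open>Counting products of eigenvalues\<close>

lemma ln_le_linear:
  fixes c x :: real
  assumes "c > 0" "x > 0"
  shows "ln x \<le> c * x - ln c"
  using ln_le_minus_one[of "c * x"] assms by (simp add: ln_mult)

text \<open>Here \<open>y\<close> stands for 1/\<epsilon>; the left side will bound the exponent 2 t
  ln(1/\<epsilon>) of the moment estimate. The constant \<open>C\<close> absorbs the range where
  sqrt(y) ln(y) is not yet dominated by y.\<close>

lemma sqrt_ln_le_linear:
  fixes b c k :: real
  assumes "b > 0" "k \<ge> 0" "c \<ge> 0"
  shows "\<exists>C. \<forall>y\<ge>1. k * (sqrt y + c) * ln y \<le> b * y + C"
proof -
  have "\<forall>\<^sub>F y in at_top. k * (sqrt y + c) * ln y \<le> b * y"
    using \<open>b > 0\<close> by real_asymp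
  then obtain Y0 where Y0: "\<And>y. y \<ge> Y0 \<Longrightarrow> k * (sqrt y + c) * ln y \<le> b * y"
    unfolding eventually_at_top_linorder by blast
  define Y where "Y = max Y0 1"
  have "k * (sqrt y + c) * ln y \<le> b * y + k * (sqrt Y + c) * ln Y" if "y \<ge> 1" for y
  proof (cases "y \<ge> Y")
    case True
    have "0 \<le> k * (sqrt Y + c) * ln Y" using assms by (simp add: Y_def)
    with Y0[of y] True show ?thesis by (simp add: Y_def)
  next
    case False
    then have "k * (sqrt y + c) * ln y \<le> k * (sqrt Y + c) * ln Y"
      using assms that by (intro mult_mono) auto
    moreover have "0 \<le> b * y" using assms that by simp
    ultimately show ?thesis by linarith
  qed
  then show ?thesis by blast
qed

text \<open>The model is \<open>lam m / lam 1\<close>, indexed from 1; \<open>a 0\<close> is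
  arbitrary, which explains the recurring side condition \<open>1 \<le> m\<close>.\<close>

locale normalized_null_sequence =
  fixes a :: "nat \<Rightarrow> real"
  assumes a_1: "a 1 = 1"
    and a_nonneg: "\<And>m. 1 \<le> m \<Longrightarrow> 0 \<le> a m"
    and a_Suc: "\<And>m. 1 \<le> m \<Longrightarrow> a (Suc m) \<le> a m"
    and a_tendsto: "a \<longlonglongrightarrow> 0"
    and a_2_pos: "0 < a 2"
begin

definition tuples :: "real \<Rightarrow> nat \<Rightarrow> (nat \<Rightarrow> nat) set" where
  "tuples \<epsilon> d = {i \<in> PiE {..<d} (\<lambda>_. {1..}). \<epsilon>\<^sup>2 < (\<Prod>j<d. a (i j))}"

text \<open>For x > 0 this is the counting function of the sequence, that is, its generalised
  inverse.\<close>

definition level :: "real \<Rightarrow> nat" where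
  "level x = card {m. 1 \<le> m \<and> x < a m}"

lemma a_Suc_0 [simp]: "a (Suc 0) = 1"
  using a_1 by simp

lemma a_nonneg_Suc [simp]: "Suc 0 \<le> m \<Longrightarrow> 0 \<le> a m"
  using a_nonneg[of m] by simp

lemma a_mono: "m \<le> n \<Longrightarrow> 1 \<le> m \<Longrightarrow> a n \<le> a m"
  by (induction n rule: dec_induct) (auto intro: order_trans[OF a_Suc])

lemma a_le_1: "1 \<le> m \<Longrightarrow> a m \<le> 1"
  using a_mono[of 1 m] by simp

text \<open>Convergence to 0 makes the set finite and monotonicity makes it an initial segment. For
  x = 0 the set can be infinite, and \<open>card\<close> would then return 0.\<close>

lemma level_set: "{m. 1 \<le> m \<and> x < a m} = {1..level x}" if "x > 0"
proof -
  let ?A = "{m. 1 \<le> m \<and> x < a m}"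
  obtain k where k: "\<And>m. m \<ge> k \<Longrightarrow> norm (a m) < x"
    using LIMSEQ_D[OF a_tendsto \<open>x > 0\<close>] by auto
  have "m < k" if "m \<in> ?A" for m using k[of m] that by force
  then have fin: "finite ?A" using finite_nat_set_iff_bounded by blast
  show ?thesis
  proof (cases "?A = {}")
    case False
    have "?A = {1..Max ?A}"
    proof (intro equalityI subsetI)
      fix m assume "m \<in> {1..Max ?A}"
      moreover have "Max ?A \<in> ?A" using Max_in[OF fin False] .
      ultimately show "m \<in> ?A" using a_mono[of m "Max ?A"] by auto
    qed (use fin in auto)
    moreover from this have "card ?A = Max ?A" by (metis card_atLeastAtMost diff_Suc_1)
    ultimately show ?thesis by (simp add: level_def)
  next
    case True
    then show ?thesis by (simp only: level_def card.empty) simp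
  qed
qed

lemma level_ge_1: "1 \<le> level x" if "0 < x" "x < 1"
proof -
  have "1 \<in> {m. 1 \<le> m \<and> x < a m}" using that by simp
  then show ?thesis unfolding level_set[OF that(1)] by simp
qed

lemma prod_a_le: "(\<Prod>j\<in>J. a (i j)) \<le> (\<Prod>j\<in>K. a (i j))"
  if "finite J" "K \<subseteq> J" "\<And>j. j \<in> J \<Longrightarrow> 1 \<le> i j"
proof -
  have "(\<Prod>j\<in>J. a (i j)) = (\<Prod>j\<in>J - K. a (i j)) * (\<Prod>j\<in>K. a (i j))"
    using that by (intro prod.subset_diff) auto
  also have "\<dots> \<le> 1 * (\<Prod>j\<in>K. a (i j))"
    using that by (intro mult_right_mono prod_le_1 prod_nonneg ballI conjI) (auto intro: a_le_1)
  finally show ?thesis by simp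
qed

lemma tuplesD:
  assumes "i \<in> tuples \<epsilon> d"
  shows "i \<in> PiE {..<d} (\<lambda>_. {1..})" "\<epsilon>\<^sup>2 < (\<Prod>j<d. a (i j))" "\<And>j. j < d \<Longrightarrow> 1 \<le> i j"
    "\<And>j. j < d \<Longrightarrow> \<epsilon>\<^sup>2 < a (i j)"
proof -
  show 1: "i \<in> PiE {..<d} (\<lambda>_. {1..})" and 2: "\<epsilon>\<^sup>2 < (\<Prod>j<d. a (i j))"
    using assms by (simp_all add: tuples_def)
  show 3: "1 \<le> i j" if "j < d" for j using PiE_mem[OF 1, of j] that by simp
  show "\<epsilon>\<^sup>2 < a (i j)" if "j < d" for j
    using 2 prod_a_le[of "{..<d}" "{j}" i] 3 that by simp
qed

lemma finite_tuples: "finite (tuples \<epsilon> d)" if "\<epsilon> > 0"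
proof (rule finite_subset)
  show "tuples \<epsilon> d \<subseteq> PiE {..<d} (\<lambda>_. {1..level (\<epsilon>\<^sup>2)})"
  proof
    fix i assume i: "i \<in> tuples \<epsilon> d"
    have "i j \<in> {1..level (\<epsilon>\<^sup>2)}" if "j < d" for j
    proof -
      have "\<epsilon>\<^sup>2 > 0" using \<open>\<epsilon> > 0\<close> by simp
      then show ?thesis using tuplesD(3,4)[OF i that] unfolding level_set[symmetric, OF \<open>\<epsilon>\<^sup>2 > 0\<close>] by simp
    qed
    then show "i \<in> PiE {..<d} (\<lambda>_. {1..level (\<epsilon>\<^sup>2)})"
      using PiE_arb[OF tuplesD(1)[OF i]] by (intro PiE_I) simp_all
  qed
  show "finite (PiE {..<d} (\<lambda>_. {1..level (\<epsilon>\<^sup>2)}))" by (rule finite_PiE) simp_all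
qed

lemma card_tuples_ge_1: "1 \<le> card (tuples \<epsilon> d)" if "0 < \<epsilon>" "\<epsilon> < 1"
proof -
  have "\<epsilon>\<^sup>2 < 1" using that by (simp add: power_less_one_iff)
  then have "(\<lambda>j\<in>{..<d}. 1) \<in> tuples \<epsilon> d" by (auto simp: tuples_def)
  then have "card (tuples \<epsilon> d) \<noteq> 0" using finite_tuples[OF that(1)] by auto
  then show ?thesis by simp
qed

lemma card_tuples_equal:
  assumes "a 2 = 1"
  shows "2 ^ d \<le> card (tuples (1/2) d)"
proof -
  have "PiE {..<d} (\<lambda>_. {1, 2}) \<subseteq> tuples (1/2) d"
  proof
    fix i :: "nat \<Rightarrow> nat" assume i: "i \<in> PiE {..<d} (\<lambda>_. {1, 2})"
    then have mem: "i j \<in> {1, 2}" if "j < d" for j using that by (auto dest: PiE_mem)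
    have "(\<Prod>j<d. a (i j)) = (\<Prod>j<d. 1)"
      by (intro prod.cong refl) (use mem assms in fastforce)
    moreover have "i \<in> PiE {..<d} (\<lambda>_. {1..})"
      using mem PiE_arb[OF i] by (intro PiE_I) force+
    ultimately show "i \<in> tuples (1/2) d" by (simp add: tuples_def power_divide)
  qed
  then have "card (PiE {..<d} (\<lambda>_. {1, 2 :: nat})) \<le> card (tuples (1/2) d)"
    by (intro card_mono finite_tuples) simp_all
  then show ?thesis by (simp add: card_PiE numeral_2_eq_2)
qed

text \<open>Choosing \<open>k\<close> positions for the index 2 and filling the rest with 1 gives
  distinct tuples, each with product \<open>a 2 ^ k\<close>.\<close>

lemma card_tuples_ge_binomial:
  assumes "\<epsilon> > 0" "\<epsilon>\<^sup>2 < a 2 ^ k"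
  shows "d choose k \<le> card (tuples \<epsilon> d)"
proof -
  define h where "h B = (\<lambda>j\<in>{..<d}. if j \<in> B then 2 else 1 :: nat)" for B
  have "inj_on h {B. B \<subseteq> {..<d} \<and> card B = k}"
  proof (rule inj_onI)
    fix B B' assume B: "B \<in> {B. B \<subseteq> {..<d} \<and> card B = k}" "B' \<in> {B. B \<subseteq> {..<d} \<and> card B = k}"
      and eq: "h B = h B'"
    have "j \<in> B \<longleftrightarrow> j \<in> B'" if "j < d" for j
      using fun_cong[OF eq, of j] that by (simp add: h_def split: if_splits)
    then show "B = B'" using B by auto
  qed
  moreover have "h ` {B. B \<subseteq> {..<d} \<and> card B = k} \<subseteq> tuples \<epsilon> d"
  proof
    fix i assume "i \<in> h ` {B. B \<subseteq> {..<d} \<and> card B = k}"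
    then obtain B where B: "B \<subseteq> {..<d}" "card B = k" and i: "i = h B" by auto
    have "(\<Prod>j<d. a (i j)) = (\<Prod>j<d. if j \<in> B then a 2 else 1)"
      by (intro prod.cong) (auto simp: i h_def)
    also have "\<dots> = a 2 ^ k"
      using B by (simp add: prod.If_cases Int_absorb1)
    finally show "i \<in> tuples \<epsilon> d" using assms(2) by (auto simp: tuples_def i h_def)
  qed
  ultimately have "card {B. B \<subseteq> {..<d} \<and> card B = k} \<le> card (tuples \<epsilon> d)"
    using finite_tuples[OF assms(1)] by (rule card_inj_on_le)
  then show ?thesis by (simp add: n_subsets)
qed

text \<open>If two entries of a tuple had \<open>a (i j) \<le> \<epsilon>\<close>, the product would be at most \<open>\<epsilon>\<^sup>2\<close>; hence all
  entries but one lie in the much smaller set \<open>{1..level \<epsilon>}\<close>.\<close>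

lemma card_tuples_le:
  assumes \<epsilon>: "0 < \<epsilon>" "\<epsilon> < 1" and "1 \<le> d"
  shows "card (tuples \<epsilon> d) \<le> d * level (\<epsilon>\<^sup>2) *
    card {i \<in> PiE {..<d} (\<lambda>_. {1..level \<epsilon>}). \<epsilon>\<^sup>2 < (\<Prod>j<d. a (i j))}"
    (is "_ \<le> d * _ * card ?Z")
proof -
  have \<epsilon>2: "\<epsilon>\<^sup>2 > 0" using \<epsilon> by simp
  let ?P = "{..<d} \<times> {1..level (\<epsilon>\<^sup>2)} \<times> ?Z"
  have "finite (PiE {..<d} (\<lambda>_. {1..level \<epsilon>}))" by (rule finite_PiE) simp_all
  then have finZ: "finite ?Z" by (rule rev_finite_subset) blast
  have "tuples \<epsilon> d \<subseteq> (\<lambda>(j, m, z). z(j := m)) ` ?P"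
  proof
    fix i assume i: "i \<in> tuples \<epsilon> d"
    note iD = tuplesD[OF i]
    have two: "j = k" if "j < d" "k < d" "a (i j) \<le> \<epsilon>" "a (i k) \<le> \<epsilon>" for j k
    proof (rule ccontr)
      assume "j \<noteq> k"
      have "(\<Prod>l<d. a (i l)) \<le> (\<Prod>l\<in>{j, k}. a (i l))"
        by (rule prod_a_le) (use that iD(3) in auto)
      also have "\<dots> = a (i j) * a (i k)" using \<open>j \<noteq> k\<close> by simp
      also have "\<dots> \<le> \<epsilon> * \<epsilon>" using that iD(3) \<epsilon> a_nonneg by (intro mult_mono) auto
      finally show False using iD(2) by (simp add: power2_eq_square)
    qed
    obtain j where j: "j < d" "\<And>k. k < d \<Longrightarrow> k \<noteq> j \<Longrightarrow> \<epsilon> < a (i k)"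
    proof (cases "\<exists>j<d. a (i j) \<le> \<epsilon>")
      case True
      then show ?thesis using that two by (meson not_le)
    next
      case False
      \<comment> \<open>Without an exceptional entry any position serves as \<open>j\<close>;
        position 0 exists because \<open>1 \<le> d\<close>.\<close>
      then show ?thesis using that[of 0] \<open>1 \<le> d\<close> by (auto simp: not_le)
    qed
    \<comment> \<open>Resetting the exceptional entry to 1 cannot lower the product, as
      \<open>a 1\<close> is the maximum 1, and 1 > \<epsilon> puts the new entry into the small
      index set. The tuple is recovered from \<open>z\<close>, the position and the old
      entry.\<close>
    define z where "z = i(j := 1)"
    have "i j \<in> {1..level (\<epsilon>\<^sup>2)}"
      using iD(3,4)[OF j(1)] unfolding level_set[symmetric, OF \<epsilon>2] by simp
    moreover have "z \<in> ?Z"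
    proof -
      have "z k \<in> {1..level \<epsilon>}" if "k < d" for k
        unfolding level_set[symmetric, OF \<epsilon>(1)] using j(2)[OF that] iD(3)[OF that] \<epsilon>
        by (auto simp: z_def)
      then have "z \<in> PiE {..<d} (\<lambda>_. {1..level \<epsilon>})"
        using PiE_arb[OF iD(1)] j(1) by (intro PiE_I) (auto simp: z_def)
      moreover have "(\<Prod>k<d. a (i k)) \<le> (\<Prod>k<d. a (z k))"
        using iD(3) by (intro prod_mono) (auto simp: z_def intro: a_le_1)
      ultimately show ?thesis using iD(2) by simp
    qed
    moreover have "i = z(j := i j)" by (simp add: z_def)
    ultimately show "i \<in> (\<lambda>(j, m, z). z(j := m)) ` ?P"
      using j(1) by (intro image_eqI[of _ _ "(j, i j, z)"]) simp_all
  qed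
  then have "card (tuples \<epsilon> d) \<le> card ?P"
    using finZ by (intro surj_card_le) auto
  then show ?thesis by (simp add: card_cartesian_product mult.assoc)
qed

text \<open>Rankin's trick: each tuple is counted with weight \<open>(\<Prod>j<d. a (i j))\<^sup>t / \<epsilon>\<^sup>2\<^sup>t \<ge> 1\<close>, and the
  sum of these weights factorises.\<close>

lemma card_restricted_tuples_le:
  assumes "\<epsilon> > 0"
  shows "real (card {i \<in> PiE {..<d} (\<lambda>_. {1..M}). \<epsilon>\<^sup>2 < (\<Prod>j<d. a (i j))})
    \<le> (1 + real M * a 2 ^ t) ^ d / \<epsilon> ^ (2 * t)" (is "real (card ?Z) \<le> _")
proof -
  have "real (card ?Z) * \<epsilon> ^ (2 * t) = (\<Sum>i\<in>?Z. \<epsilon> ^ (2 * t))" by simp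
  also have "\<dots> \<le> (\<Sum>i\<in>?Z. \<Prod>j<d. a (i j) ^ t)"
  proof (rule sum_mono)
    fix i assume "i \<in> ?Z"
    then have "(\<epsilon>\<^sup>2) ^ t \<le> (\<Prod>j<d. a (i j)) ^ t" by (intro power_mono) auto
    then show "\<epsilon> ^ (2 * t) \<le> (\<Prod>j<d. a (i j) ^ t)" by (simp add: prod_power_distrib power_mult)
  qed
  also have "\<dots> \<le> (\<Sum>i\<in>PiE {..<d} (\<lambda>_. {1..M}). \<Prod>j<d. a (i j) ^ t)"
  proof (rule sum_mono2)
    show "finite (PiE {..<d} (\<lambda>_. {1..M}))" by (rule finite_PiE) simp_all
    show "0 \<le> (\<Prod>j<d. a (i j) ^ t)" if "i \<in> PiE {..<d} (\<lambda>_. {1..M}) - ?Z" for i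
      using PiE_mem[of i "{..<d}" "\<lambda>_. {1..M}"] that
      by (intro prod_nonneg ballI zero_le_power a_nonneg) auto
  qed auto
  also have "\<dots> = (\<Sum>m=1..M. a m ^ t) ^ d"
    by (subst prod_sum_PiE[symmetric]) simp_all
  also have "\<dots> \<le> (1 + real M * a 2 ^ t) ^ d"
  proof (rule power_mono)
    \<comment> \<open>The index 1 contributes 1 for every \<open>t\<close>; all other terms are at
      most \<open>a 2 ^ t\<close>, which is what a large \<open>t\<close> makes small.\<close>
    have "(\<Sum>m=1..M. a m ^ t) \<le> (\<Sum>m=1..M. (if m = 1 then 1 else 0) + a 2 ^ t)"
    proof (rule sum_mono)
      fix m assume "m \<in> {1..M}"
      then show "a m ^ t \<le> (if m = 1 then 1 else 0) + a 2 ^ t"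
        using a_mono[of 2 m] a_2_pos a_nonneg[of m] by (auto intro!: power_mono)
    qed
    also have "\<dots> \<le> 1 + real M * a 2 ^ t" by (simp add: sum.distrib)
    finally show "(\<Sum>m=1..M. a m ^ t) \<le> 1 + real M * a 2 ^ t" .
  qed (auto intro!: sum_nonneg)
  finally show ?thesis using assms by (simp add: field_simps)
qed

text \<open>For n = level x one has x < a n, and a n \<le> \<eta>^2 / (ln n)^2 for large n
  rearranges to ln n \<le> \<eta> / sqrt x. The constant covers the remaining n; the cutoff
  \<open>n1\<close> is at least 2 so that ln n is positive beyond it.\<close>

lemma ln_level_le:
  assumes small: "a \<in> o(\<lambda>n. ln (real n) powr (- 2))" and "\<eta> > 0"
  obtains C where "C \<ge> 0" "\<And>x. 0 < x \<Longrightarrow> x < 1 \<Longrightarrow> ln (real (level x)) \<le> \<eta> / sqrt x + C"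
proof -
  have "\<forall>\<^sub>F n in sequentially. norm (a n) \<le> \<eta>\<^sup>2 * norm (ln (real n) powr (- 2))"
    using landau_o.smallD[OF small, of "\<eta>\<^sup>2"] \<open>\<eta> > 0\<close> by simp
  then obtain n0 where n0: "\<And>n. n \<ge> n0 \<Longrightarrow> \<bar>a n\<bar> \<le> \<eta>\<^sup>2 * ln (real n) powr (- 2)"
    unfolding eventually_sequentially by auto
  define n1 where "n1 = max n0 2"
  have "ln (real (level x)) \<le> \<eta> / sqrt x + ln (real n1)" if x: "0 < x" "x < 1" for x
  proof -
    define n where "n = level x"
    have n: "1 \<le> n" using level_ge_1[OF x] by (simp add: n_def)
    have "n \<in> {m. 1 \<le> m \<and> x < a m}"
      unfolding level_set[OF x(1)] using n by (simp add: n_def)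
    then have "x < a n" by simp
    have "ln (real n) \<le> \<eta> / sqrt x + ln (real n1)"
    proof (cases "n \<ge> n1")
      case True
      then have "n \<ge> 2" "n \<ge> n0" by (simp_all add: n1_def)
      then have ln_pos: "ln (real n) > 0" by simp
      have "x < \<eta>\<^sup>2 * ln (real n) powr (- 2)" using \<open>x < a n\<close> n0[OF \<open>n \<ge> n0\<close>] by linarith
      also have "ln (real n) powr (- 2) = 1 / (ln (real n))\<^sup>2"
        using ln_pos by (simp add: powr_minus powr_numeral divide_inverse)
      finally have "(sqrt x * ln (real n))\<^sup>2 \<le> \<eta>\<^sup>2"
        using ln_pos x by (simp add: power_mult_distrib field_simps)
      then have "sqrt x * ln (real n) \<le> \<eta>" by (rule power2_le_imp_le) (use \<open>\<eta> > 0\<close> in simp)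
      then have "ln (real n) \<le> \<eta> / sqrt x" using x by (simp add: field_simps)
      moreover have "0 \<le> ln (real n1)" by (simp add: n1_def)
      ultimately show ?thesis by linarith
    next
      case False
      then have "ln (real n) \<le> ln (real n1)" using n by simp
      moreover have "0 \<le> \<eta> / sqrt x" using x \<open>\<eta> > 0\<close> by simp
      ultimately show ?thesis by linarith
    qed
    then show ?thesis by (simp add: n_def)
  qed
  moreover have "0 \<le> ln (real n1)" by (simp add: n1_def)
  ultimately show thesis by (rule that[rotated])
qed

text \<open>The two counting bounds split the logarithm into four terms. ln d and the d-fold product
  are charged to \<delta> d; the choices for the exceptional entry and the factor \<epsilon>^(-2t)
  are charged to \<delta> / \<epsilon>. Each budget is shared by two terms, hence
  \<open>\<delta>' = \<delta> / 2\<close>.\<close>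

lemma ln_card_tuples_le:
  assumes small: "a \<in> o(\<lambda>n. ln (real n) powr (- 2))" and "a 2 < 1" and "\<delta> > 0"
  shows "\<exists>C. \<forall>\<epsilon> d. 0 < \<epsilon> \<and> \<epsilon> < 1 \<and> 1 \<le> d \<longrightarrow>
    ln (real (card (tuples \<epsilon> d))) \<le> \<delta> * (inverse \<epsilon> + real d) + C"
proof -
  define \<delta>' where "\<delta>' = \<delta> / 2"
  have "\<delta>' > 0" using \<open>\<delta> > 0\<close> by (simp add: \<delta>'_def)
  define b where "b = - ln (a 2)"
  have "b > 0" using \<open>a 2 < 1\<close> a_2_pos by (simp add: b_def)
  obtain C1 where C1: "C1 \<ge> 0" "\<And>x. 0 < x \<Longrightarrow> x < 1 \<Longrightarrow> ln (real (level x)) \<le> \<delta>' / sqrt x + C1"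
    using ln_level_le[OF small \<open>\<delta>' > 0\<close>] by blast
  \<comment> \<open>At level \<epsilon> the coefficient 1 is small enough: ln M of order
    \<epsilon>^(-1/2) leaves room for the logarithm that multiplies it.\<close>
  obtain C2 where C2: "C2 \<ge> 0" "\<And>x. 0 < x \<Longrightarrow> x < 1 \<Longrightarrow> ln (real (level x)) \<le> 1 / sqrt x + C2"
    using ln_level_le[OF small zero_less_one] by blast
  \<comment> \<open>Besides \<open>C2\<close>, this collects |ln \<delta>'| from the choice of
    \<open>t\<close> and \<open>b\<close> from rounding \<open>t\<close> up.\<close>
  define c where "c = C2 + \<bar>ln \<delta>'\<bar> + b"
  obtain C3 where C3: "\<And>y. y \<ge> 1 \<Longrightarrow> 2 / b * (sqrt y + c) * ln y \<le> \<delta>' * y + C3"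
    using sqrt_ln_le_linear[OF \<open>\<delta>' > 0\<close>, of "2 / b" c] \<open>b > 0\<close> \<open>C2 \<ge> 0\<close> by (auto simp: c_def)
  have "ln (real (card (tuples \<epsilon> d))) \<le> \<delta> * (inverse \<epsilon> + real d) + (C1 + C3 - ln \<delta>')"
    if \<epsilon>: "0 < \<epsilon>" "\<epsilon> < 1" and "1 \<le> d" for \<epsilon> d
  proof -
    have \<epsilon>2: "0 < \<epsilon>\<^sup>2" "\<epsilon>\<^sup>2 < 1" using \<epsilon> by (simp_all add: power_less_one_iff)
    define M where "M = level \<epsilon>"
    have M: "M \<ge> 1" using level_ge_1[OF \<epsilon>] by (simp add: M_def)
    have l: "level (\<epsilon>\<^sup>2) \<ge> 1" by (rule level_ge_1[OF \<epsilon>2])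
    \<comment> \<open>As \<open>a 2\<close> is exp(-b), this is the least natural \<open>t\<close>
      with \<open>M * a 2 ^ t \<le> \<delta>'\<close>; \<open>nat\<close> covers a negative
      quotient.\<close>
    define t where "t = nat \<lceil>(ln (real M) - ln \<delta>') / b\<rceil>"
    have t_ge: "(ln (real M) - ln \<delta>') / b \<le> real t" by (simp add: t_def real_nat_ceiling_ge)
    have "real M * a 2 ^ t = exp (ln (real M) - real t * b)"
      using M a_2_pos by (simp add: b_def exp_diff exp_minus exp_of_nat_mult exp_add)
    also have "\<dots> \<le> exp (ln \<delta>')" using t_ge \<open>b > 0\<close> by (simp add: field_simps)
    finally have Mb: "real M * a 2 ^ t \<le> \<delta>'" using \<open>\<delta>' > 0\<close> by simp
    have lnM: "0 \<le> ln (real M)" "ln (real M) \<le> sqrt (inverse \<epsilon>) + C2"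
      using C2(2)[OF \<epsilon>] M by (simp_all add: M_def real_sqrt_inverse divide_inverse)
    have "real t \<le> (ln (real M) + \<bar>ln \<delta>'\<bar>) / b + 1"
    proof -
      have "(ln (real M) - ln \<delta>') / b \<le> (ln (real M) + \<bar>ln \<delta>'\<bar>) / b"
        using \<open>b > 0\<close> by (intro divide_right_mono) auto
      moreover have "0 \<le> (ln (real M) + \<bar>ln \<delta>'\<bar>) / b" using \<open>b > 0\<close> lnM(1) by simp
      ultimately show ?thesis unfolding t_def by linarith
    qed
    also have "\<dots> \<le> (sqrt (inverse \<epsilon>) + c) / b"
    proof -
      have "(ln (real M) + \<bar>ln \<delta>'\<bar>) / b + 1 = (ln (real M) + \<bar>ln \<delta>'\<bar> + b) / b"
        using \<open>b > 0\<close> by (simp add: add_divide_distrib)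
      also have "\<dots> \<le> (sqrt (inverse \<epsilon>) + c) / b"
        using lnM(2) \<open>b > 0\<close> by (intro divide_right_mono) (auto simp: c_def)
      finally show ?thesis .
    qed
    finally have "2 * real t * ln (inverse \<epsilon>) \<le> 2 * ((sqrt (inverse \<epsilon>) + c) / b) * ln (inverse \<epsilon>)"
      using \<epsilon> by (intro mult_right_mono mult_left_mono) (auto simp: ln_inverse)
    also have "\<dots> \<le> \<delta>' * inverse \<epsilon> + C3"
      using C3[of "inverse \<epsilon>"] \<epsilon> by (simp add: one_le_inverse_iff)
    finally have t: "2 * real t * ln (inverse \<epsilon>) \<le> \<delta>' * inverse \<epsilon> + C3" .
    define R where "R = (1 + real M * a 2 ^ t) ^ d / \<epsilon> ^ (2 * t)"
    have "1 + real M * a 2 ^ t > 0" using a_2_pos by (simp add: add_pos_nonneg)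
    then have "R > 0" using \<epsilon> by (simp add: R_def)
    have "ln R = real d * ln (1 + real M * a 2 ^ t) + 2 * real t * ln (inverse \<epsilon>)"
      using \<open>1 + real M * a 2 ^ t > 0\<close> \<epsilon> by (simp add: R_def ln_div ln_realpow ln_inverse)
    also have "ln (1 + real M * a 2 ^ t) \<le> \<delta>'"
      using ln_add_one_self_le_self[of "real M * a 2 ^ t"] a_2_pos Mb by simp
    finally have lnR: "ln R \<le> real d * \<delta>' + (\<delta>' * inverse \<epsilon> + C3)"
      using t by (simp add: mult_left_mono)
    have "card (tuples \<epsilon> d) \<le> d * level (\<epsilon>\<^sup>2) *
        card {i \<in> PiE {..<d} (\<lambda>_. {1..M}). \<epsilon>\<^sup>2 < (\<Prod>j<d. a (i j))}"
      unfolding M_def by (rule card_tuples_le[OF \<epsilon> \<open>1 \<le> d\<close>])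
    then have "real (card (tuples \<epsilon> d)) \<le> real d * real (level (\<epsilon>\<^sup>2)) *
        real (card {i \<in> PiE {..<d} (\<lambda>_. {1..M}). \<epsilon>\<^sup>2 < (\<Prod>j<d. a (i j))})"
      unfolding of_nat_mult[symmetric] by (rule of_nat_mono)
    also have "\<dots> \<le> real d * real (level (\<epsilon>\<^sup>2)) * R"
      unfolding R_def by (intro mult_left_mono card_restricted_tuples_le[OF \<epsilon>(1)]) simp
    finally have "ln (real (card (tuples \<epsilon> d))) \<le> ln (real d * real (level (\<epsilon>\<^sup>2)) * R)"
      using card_tuples_ge_1[OF \<epsilon>, of d] by (intro ln_mono) auto
    also have "\<dots> = ln (real d) + ln (real (level (\<epsilon>\<^sup>2))) + ln R"
      using \<open>1 \<le> d\<close> l \<open>R > 0\<close> by (simp add: ln_mult)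
    also have "ln (real d) \<le> \<delta>' * real d - ln \<delta>'"
      using \<open>\<delta>' > 0\<close> \<open>1 \<le> d\<close> by (intro ln_le_linear) auto
    also have "ln (real (level (\<epsilon>\<^sup>2))) \<le> \<delta>' * inverse \<epsilon> + C1"
      using C1(2)[OF \<epsilon>2] \<epsilon> by (simp add: divide_inverse)
    finally show ?thesis using lnR by (simp add: \<delta>'_def field_simps)
  qed
  then show ?thesis by blast
qed

section \<open>From tuple counts to tractability\<close>

context
  fixes N :: "real \<Rightarrow> nat \<Rightarrow> nat"
  assumes N: "\<And>\<epsilon> d. 0 < \<epsilon> \<Longrightarrow> 1 \<le> d \<Longrightarrow> N \<epsilon> d = card (tuples \<epsilon> d)"
begin

lemma curse_if_equal:
  assumes "a 2 = 1"
  shows "curse_of_dimensionality N"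
proof -
  have "1 * (1 + 1) ^ d \<le> real (N (1/2) d)" if "1 \<le> d" for d
  proof -
    have "real (2 ^ d) \<le> real (N (1/2) d)"
      using card_tuples_equal[OF assms, of d] N[of "1/2" d] that by (simp only: of_nat_le_iff)
    then show ?thesis by simp
  qed
  then have "{1..} \<subseteq> {d. 1 \<le> d \<and> 1 * (1 + 1) ^ d \<le> real (N (1/2) d)}" by auto
  then have "infinite {d. 1 \<le> d \<and> 1 * (1 + 1) ^ d \<le> real (N (1/2) d)}"
    using infinite_Ici infinite_super by blast
  then show ?thesis
    unfolding curse_of_dimensionality_def
    by (intro exI[of _ "1/2"] exI[of _ 1] conjI) auto
qed

text \<open>At a fixed small \<epsilon> the count is at least (d/k)^k, which outgrows d^q as soon as
  k > q.\<close>

lemma not_polynomially_tractable: "\<not> polynomially_tractable N"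
proof
  assume "polynomially_tractable N"
  then obtain C p q where "C > 0" "q \<ge> 0"
    and N_le: "\<And>\<epsilon> d. 0 < \<epsilon> \<Longrightarrow> \<epsilon> \<le> 1 \<Longrightarrow> 1 \<le> d \<Longrightarrow> real (N \<epsilon> d) \<le> C * \<epsilon> powr (- p) * real d powr q"
    unfolding polynomially_tractable_def by blast
  \<comment> \<open>Then \<open>k - 1\<close> is still at least \<open>q\<close>, so comparing
    powers of \<open>d\<close> leaves one spare factor \<open>d\<close> that would have to stay
    below the constant \<open>D\<close>.\<close>
  define k where "k = Suc (nat \<lceil>q\<rceil>)"
  \<comment> \<open>Since \<epsilon> \<le> 1, \<epsilon>^2 \<le> \<epsilon>, and halving makes this
    strictly less than \<open>a 2 ^ k\<close>.\<close>
  define \<epsilon> where "\<epsilon> = a 2 ^ k / 2"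
  have b: "0 < a 2 ^ k" "a 2 ^ k \<le> 1" using a_2_pos a_le_1[of 2] by (simp_all add: power_le_one)
  then have \<epsilon>: "0 < \<epsilon>" "\<epsilon> \<le> 1" by (simp_all add: \<epsilon>_def)
  have "\<epsilon> * \<epsilon> \<le> \<epsilon> * 1" using \<epsilon> by (intro mult_left_mono) auto
  also have "\<dots> < a 2 ^ k" using b by (simp add: \<epsilon>_def)
  finally have \<epsilon>2: "\<epsilon>\<^sup>2 < a 2 ^ k" by (simp add: power2_eq_square)
  define D where "D = C * \<epsilon> powr (- p) * real k ^ k"
  have "real d \<le> D" if d: "d \<ge> k" "d \<ge> 1" for d
  proof -
    have "(real d / real k) ^ k \<le> real (d choose k)" by (rule binomial_ge_n_over_k_pow_k[OF d(1)])
    also have "\<dots> \<le> real (N \<epsilon> d)"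
      using card_tuples_ge_binomial[OF \<epsilon>(1) \<epsilon>2, of d] N[OF \<epsilon>(1) d(2)] by simp
    also have "\<dots> \<le> C * \<epsilon> powr (- p) * real d powr q" by (rule N_le[OF \<epsilon> d(2)])
    also have "\<dots> \<le> C * \<epsilon> powr (- p) * real d powr (real (k - 1))"
      using \<open>C > 0\<close> d(2) by (intro mult_left_mono powr_mono) (auto simp: k_def real_nat_ceiling_ge)
    also have "real d powr (real (k - 1)) = real d ^ (k - 1)"
      using d(2) by (simp add: powr_realpow)
    finally have "real d ^ k \<le> D * real d ^ (k - 1)"
      by (simp add: D_def power_divide divide_le_eq k_def mult_ac)
    then have "real d * real d ^ (k - 1) \<le> D * real d ^ (k - 1)"
      by (simp add: k_def)
    then show ?thesis using d(2) by simp
  qed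
  then have "real (max k (Suc (nat \<lceil>D\<rceil>))) \<le> D" by simp
  moreover have "D < real (max k (Suc (nat \<lceil>D\<rceil>)))" by linarith
  ultimately show False by simp
qed

text \<open>For d = 1 the threshold can follow the sequence: with \<epsilon>_n^2 just below a_(n+1),
  at least n+1 indices are counted, so weak tractability forces \<epsilon>_n ln(n+1) to 0. Squaring
  gives the decay.\<close>

lemma weakly_tractable_imp_smallo:
  assumes "weakly_tractable N"
  shows "a \<in> o(\<lambda>n. ln (real n) powr (- 2))"
proof (cases "\<exists>m\<ge>1. a m \<le> 0")
  \<comment> \<open>A vanishing term makes all later terms vanish, so the claim is immediate; the
    accuracies chosen in the other case would not be positive here.\<close>
  case True
  then obtain m where m: "m \<ge> 1" "a m \<le> 0" by blast
  have "a n = 0" if "n \<ge> m" for n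
    using a_mono[OF that m(1)] a_nonneg[of n] m that by linarith
  then have "\<forall>\<^sub>F n in sequentially. a n = 0" unfolding eventually_sequentially by blast
  then show ?thesis by (simp add: landau_o.small.in_cong)
next
  case False
  then have pos: "0 < a m" if "1 \<le> m" for m using that by force
  \<comment> \<open>The factor 1/2 makes \<epsilon>^2 strictly smaller than
    \<open>a (Suc n)\<close>, so the strict inequality in \<open>tuples\<close> admits all indices
    up to n+1, and it keeps \<epsilon> below 1. The shift by \<open>Suc\<close> avoids
    \<open>a 0\<close>.\<close>
  define \<epsilon> where "\<epsilon> n = sqrt (a (Suc n) / 2)" for n
  have \<epsilon>: "0 < \<epsilon> n" "\<epsilon> n < 1" for n
    using pos[of "Suc n"] a_le_1[of "Suc n"] by (simp_all add: \<epsilon>_def)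
  have "\<epsilon> \<longlonglongrightarrow> 0"
  proof -
    have "(\<lambda>n. sqrt (a (Suc n) / 2)) \<longlonglongrightarrow> sqrt (0 / 2)"
      by (intro tendsto_intros LIMSEQ_Suc a_tendsto) simp
    then show ?thesis by (simp add: \<epsilon>_def[abs_def])
  qed
  then have "filterlim (\<lambda>n. inverse (\<epsilon> n)) at_top sequentially"
    using \<epsilon>(1) by (intro filterlim_inverse_at_top) auto
  then have "filterlim (\<lambda>n. real 1 + inverse (\<epsilon> n)) at_top sequentially"
    by (rule filterlim_tendsto_add_at_top[OF tendsto_const])
  then have r: "(\<lambda>n. ln (real (N (\<epsilon> n) 1)) / (inverse (\<epsilon> n) + real 1)) \<longlonglongrightarrow> 0"
    using assms \<epsilon> unfolding weakly_tractable_def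
    by (elim allE[of _ \<epsilon>] allE[of _ "\<lambda>_. 1"]) (auto simp: add.commute)
  have N_ge: "Suc n \<le> N (\<epsilon> n) 1" for n
  proof -
    have inj: "inj_on (\<lambda>m. \<lambda>j\<in>{..<1::nat}. m) {1..Suc n}"
      by (rule inj_onI) (metis lessThan_iff less_one restrict_apply')
    have "(\<lambda>m. \<lambda>j\<in>{..<1::nat}. m) ` {1..Suc n} \<subseteq> tuples (\<epsilon> n) 1"
    proof
      fix i assume "i \<in> (\<lambda>m. \<lambda>j\<in>{..<1::nat}. m) ` {1..Suc n}"
      then obtain m where m: "1 \<le> m" "m \<le> Suc n" and i: "i = (\<lambda>j\<in>{..<1::nat}. m)" by auto
      have "(\<epsilon> n)\<^sup>2 = a (Suc n) / 2" using pos[of "Suc n"] by (simp add: \<epsilon>_def)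
      also have "\<dots> < a m" using a_mono[OF m(2,1)] pos[of "Suc n"] by simp
      finally show "i \<in> tuples (\<epsilon> n) 1" using m by (simp add: tuples_def i)
    qed
    from card_inj_on_le[OF inj this finite_tuples[OF \<epsilon>(1)]] show ?thesis
      using N[OF \<epsilon>(1), of 1] by simp
  qed
  have "(\<lambda>n. \<epsilon> n * ln (real (Suc n))) \<longlonglongrightarrow> 0"
  proof (rule real_tendsto_sandwich[where f = "\<lambda>_. 0"])
    show "(\<lambda>n. 2 * (ln (real (N (\<epsilon> n) 1)) / (inverse (\<epsilon> n) + real 1))) \<longlonglongrightarrow> 0"
      using tendsto_mult_right_zero[OF r, of 2] by simp
    show "\<forall>\<^sub>F n in sequentially. \<epsilon> n * ln (real (Suc n))
        \<le> 2 * (ln (real (N (\<epsilon> n) 1)) / (inverse (\<epsilon> n) + real 1))"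
    proof (intro always_eventually allI)
      fix n
      have "inverse (\<epsilon> n) + 1 \<le> 2 / \<epsilon> n" using \<epsilon>[of n] by (simp add: field_simps)
      have "\<epsilon> n * ln (real (Suc n)) \<le> \<epsilon> n * ln (real (N (\<epsilon> n) 1))"
        using \<epsilon>(1)[of n] N_ge[of n] by (intro mult_left_mono ln_mono) auto
      also have "\<dots> = 2 * (ln (real (N (\<epsilon> n) 1)) / (2 / \<epsilon> n))" by simp
      also have "\<dots> \<le> 2 * (ln (real (N (\<epsilon> n) 1)) / (inverse (\<epsilon> n) + real 1))"
      proof (intro mult_left_mono divide_left_mono)
        show "0 \<le> ln (real (N (\<epsilon> n) 1))" using N_ge[of n] by simp
        show "0 < 2 / \<epsilon> n * (inverse (\<epsilon> n) + real 1)" using \<epsilon>(1)[of n] by (simp add: add_pos_pos)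
      qed (use \<open>inverse (\<epsilon> n) + 1 \<le> 2 / \<epsilon> n\<close> in auto)
      finally show "\<epsilon> n * ln (real (Suc n))
        \<le> 2 * (ln (real (N (\<epsilon> n) 1)) / (inverse (\<epsilon> n) + real 1))" .
    qed
    show "\<forall>\<^sub>F n in sequentially. 0 \<le> \<epsilon> n * ln (real (Suc n))"
      using \<epsilon>(1)[THEN less_imp_le] by (auto intro!: always_eventually mult_nonneg_nonneg)
  qed simp
  then have "(\<lambda>n. 2 * (\<epsilon> n * ln (real (Suc n)))\<^sup>2) \<longlonglongrightarrow> 2 * 0\<^sup>2" by (intro tendsto_intros)
  moreover have eq: "2 * (\<epsilon> n * ln (real (Suc n)))\<^sup>2 = a (Suc n) * (ln (real (Suc n)))\<^sup>2" for n
    using pos[of "Suc n"] by (simp add: \<epsilon>_def power_mult_distrib)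
  ultimately have "(\<lambda>n. a (Suc n) * (ln (real (Suc n)))\<^sup>2) \<longlonglongrightarrow> 0"
    unfolding eq by (simp only: power_zero_numeral mult_zero_right)
  then have lim: "(\<lambda>n. a n * (ln (real n))\<^sup>2) \<longlonglongrightarrow> 0" by (rule LIMSEQ_imp_Suc)
  show ?thesis
  proof (rule smalloI_tendsto)
    have "\<forall>\<^sub>F n in sequentially. a n / ln (real n) powr (- 2) = a n * (ln (real n))\<^sup>2"
      using eventually_ge_at_top[of 2]
      by eventually_elim (simp add: powr_minus powr_numeral divide_inverse)
    then show "((\<lambda>n. a n / ln (real n) powr (- 2)) \<longlongrightarrow> 0) sequentially"
      using lim by (simp add: tendsto_cong)
    show "\<forall>\<^sub>F n in sequentially. ln (real n) powr (- 2) \<noteq> 0"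
      using eventually_ge_at_top[of 2] by eventually_elim simp
  qed
qed

lemma smallo_imp_weakly_tractable:
  assumes "a \<in> o(\<lambda>n. ln (real n) powr (- 2))" and "a 2 < 1"
  shows "weakly_tractable N"
  unfolding weakly_tractable_def
proof (intro allI impI, elim conjE)
  fix \<epsilon> :: "nat \<Rightarrow> real" and d :: "nat \<Rightarrow> nat"
  assume \<epsilon>d: "\<forall>k. 0 < \<epsilon> k \<and> \<epsilon> k < 1 \<and> 1 \<le> d k"
    and lim: "filterlim (\<lambda>k. inverse (\<epsilon> k) + real (d k)) at_top sequentially"
  define X where "X k = inverse (\<epsilon> k) + real (d k)" for k
  have X: "X k > 0" for k using \<epsilon>d by (simp add: X_def add_pos_nonneg)
  show "(\<lambda>k. ln (real (N (\<epsilon> k) (d k))) / (inverse (\<epsilon> k) + real (d k))) \<longlonglongrightarrow> 0"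
  proof (rule LIMSEQ_I)
    fix r :: real assume "r > 0"
    then obtain C where C: "\<And>\<epsilon> d. 0 < \<epsilon> \<Longrightarrow> \<epsilon> < 1 \<Longrightarrow> 1 \<le> d \<Longrightarrow>
        ln (real (card (tuples \<epsilon> d))) \<le> r / 2 * (inverse \<epsilon> + real d) + C"
      using ln_card_tuples_le[OF assms, of "r / 2"] by auto
    \<comment> \<open>Beyond this threshold the additive constant \<open>C\<close> is less than half
      of the allowed r X.\<close>
    obtain k0 where k0: "\<And>k. k \<ge> k0 \<Longrightarrow> X k > 2 * C / r"
      using lim unfolding X_def filterlim_at_top_dense eventually_sequentially by blast
    have "norm (ln (real (N (\<epsilon> k) (d k))) / X k - 0) < r" if "k \<ge> k0" for k
    proof -
      have card: "N (\<epsilon> k) (d k) = card (tuples (\<epsilon> k) (d k))" using N \<epsilon>d by blast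
      then have "N (\<epsilon> k) (d k) \<ge> 1" using card_tuples_ge_1 \<epsilon>d by simp
      then have "0 \<le> ln (real (N (\<epsilon> k) (d k)))" by simp
      moreover have "ln (real (N (\<epsilon> k) (d k))) < r * X k"
      proof -
        have "C < r / 2 * X k" using k0[OF that] \<open>r > 0\<close> by (simp add: field_simps)
        moreover have "ln (real (N (\<epsilon> k) (d k))) \<le> r / 2 * X k + C"
          unfolding card X_def using C \<epsilon>d by blast
        ultimately show ?thesis by linarith
      qed
      ultimately show ?thesis using X[of k] by (simp add: field_simps)
    qed
    then show "\<exists>no. \<forall>k\<ge>no. norm (ln (real (N (\<epsilon> k) (d k))) / (inverse (\<epsilon> k) + real (d k)) - 0) < r"
      unfolding X_def by blast
  qed
qed

end

end

section \<open>Tractability of scaled tensor product problems\<close>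

theorem theorem3p8:
  fixes S1 :: "'a::{real_inner, complete_space} \<Rightarrow> 'b::{real_inner, complete_space}"
    and lam s :: "nat \<Rightarrow> real"
    and tH :: "nat \<Rightarrow> (nat \<Rightarrow> 'a) \<Rightarrow> 'h::{real_inner, complete_space}"
    and H :: "nat \<Rightarrow> 'h set"
    and tG :: "nat \<Rightarrow> (nat \<Rightarrow> 'b) \<Rightarrow> 'g::{real_inner, complete_space}"
    and G :: "nat \<Rightarrow> 'g set"
    and S :: "nat \<Rightarrow> 'h \<Rightarrow> 'g"
  assumes "compact_operator S1"
    and "eigenvalue_sequence (adjoint S1 \<circ> S1) lam"
    and "lam 2 > 0"
    and "\<And>d. d \<ge> 1 \<Longrightarrow> hilbert_tensor_power d (tH d) (H d)"
    and "\<And>d. d \<ge> 1 \<Longrightarrow> hilbert_tensor_power d (tG d) (G d)"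
    and "\<And>d. d \<ge> 1 \<Longrightarrow> tensor_power_operator (tH d) (H d) (tG d) S1 (S d)"
    and "\<And>d. d \<ge> 1 \<Longrightarrow> s d > 0"
  shows "(lam 1 = lam 2 \<longrightarrow> curse_of_dimensionality (scaled_tensor_complexity s H G S)) \<and>
         (lam 1 > lam 2 \<longrightarrow>
            \<not> polynomially_tractable (scaled_tensor_complexity s H G S) \<and>
            (weakly_tractable (scaled_tensor_complexity s H G S) \<longleftrightarrow>
               lam \<in> o(\<lambda>n. ln (real n) powr (- 2))))"
proof -
  have lam_nonneg: "0 \<le> lam m" and lam_Suc: "lam (Suc m) \<le> lam m" if "1 \<le> m" for m
    using assms(2) that by (auto simp: eigenvalue_sequence_def)
  have "lam 2 \<le> lam 1" using lam_Suc[of 1] by (simp add: numeral_2_eq_2)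
  with \<open>lam 2 > 0\<close> have lam1: "lam 1 > 0" by linarith
  obtain e where
    e: "\<And>m n. \<lbrakk>1 \<le> m; 1 \<le> n; lam m > 0; lam n > 0\<rbrakk> \<Longrightarrow> e m \<bullet> e n = (if m = n then 1 else 0)"
    and S1e: "\<And>m n. \<lbrakk>1 \<le> m; 1 \<le> n; lam m > 0; lam n > 0\<rbrakk> \<Longrightarrow>
      S1 (e m) \<bullet> S1 (e n) = (if m = n then lam m else 0)"
    and null: "\<And>x. (\<And>m. 1 \<le> m \<Longrightarrow> lam m > 0 \<Longrightarrow> x \<bullet> e m = 0) \<Longrightarrow> S1 x = 0"
    and lim: "lam \<longlonglongrightarrow> 0"
    using compact_operator_singular_values[OF assms(1,2)] by blast
  define A where "A = {m. 1 \<le> m \<and> 0 < lam m}"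
  have expansion: "(\<lambda>M. \<Sum>m\<in>A \<inter> {..<M}. (x \<bullet> e m) *\<^sub>R S1 (e m)) \<longlonglongrightarrow> S1 x" for x
    by (rule orthonormal_expansion_image[OF compact_operator_bounded_linear[OF assms(1)]])
      (use e null in \<open>auto simp: A_def\<close>)
  define a where "a m = lam m / lam 1" for m
  have "a \<longlonglongrightarrow> 0" unfolding a_def[abs_def] using tendsto_divide[OF lim tendsto_const, of "lam 1"] lam1 by simp
  then interpret a: normalized_null_sequence a
    using lam1 \<open>lam 2 > 0\<close> lam_nonneg lam_Suc
    by unfold_locales (auto simp: a_def divide_right_mono)
  let ?N = "scaled_tensor_complexity s H G S"
  have N: "?N \<epsilon> d = card (a.tuples \<epsilon> d)" if "0 < \<epsilon>" "1 \<le> d" for \<epsilon> d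
  proof -
    interpret t: tensor_singular_system d S1 A e lam "tH d" "H d" "tG d" "G d" "S d"
      using e S1e expansion assms(4-6)[OF that(2)]
      by unfold_locales (auto simp: A_def)
    have prod_a: "(\<Prod>j<d. a (i j)) = t.w i / lam 1 ^ d" for i
      by (simp add: a_def t.w_def prod_dividef)
    \<comment> \<open>A product above \<epsilon>^2 has no zero factor, so indices with eigenvalue 0
      never enter a counted tuple, and ranging over \<open>A\<close> or over all positive indices
      gives the same set.\<close>
    have tuples: "{i \<in> PiE {..<d} (\<lambda>_. A). \<epsilon>\<^sup>2 * lam 1 ^ d < t.w i} = a.tuples \<epsilon> d"
    proof (intro equalityI subsetI)
      fix i assume i: "i \<in> a.tuples \<epsilon> d"
      have "i j \<in> A" if "j < d" for j
      proof -
        have "0 < a (i j)" using a.tuplesD(4)[OF i that] zero_le_power2[of \<epsilon>] by linarith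
        then show ?thesis using a.tuplesD(3)[OF i that] lam1 by (simp add: A_def a_def zero_less_divide_iff)
      qed
      then have "i \<in> PiE {..<d} (\<lambda>_. A)"
        using PiE_arb[OF a.tuplesD(1)[OF i]] by (intro PiE_I) simp_all
      then show "i \<in> {i \<in> PiE {..<d} (\<lambda>_. A). \<epsilon>\<^sup>2 * lam 1 ^ d < t.w i}"
        using a.tuplesD(2)[OF i] lam1 by (simp add: prod_a pos_less_divide_eq)
    next
      fix i assume i: "i \<in> {i \<in> PiE {..<d} (\<lambda>_. A). \<epsilon>\<^sup>2 * lam 1 ^ d < t.w i}"
      have "PiE {..<d} (\<lambda>_. A) \<subseteq> PiE {..<d} (\<lambda>_. {1..})"
        by (rule PiE_mono) (auto simp: A_def)
      with i have "i \<in> PiE {..<d} (\<lambda>_. {1..})" by blast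
      with i lam1 show "i \<in> a.tuples \<epsilon> d" by (simp add: a.tuples_def prod_a pos_less_divide_eq)
    qed
    have fin: "finite {i \<in> PiE {..<d} (\<lambda>_. A). \<epsilon>\<^sup>2 * lam 1 ^ d < t.w i}"
      unfolding tuples by (rule a.finite_tuples[OF that(1)])
    have le: "lam m \<le> lam 1" if "m \<in> A" for m
      using a.a_le_1[of m] that lam1 by (simp add: a_def A_def)
    have "1 \<in> A" using lam1 by (simp add: A_def)
    then show ?thesis
      unfolding scaled_tensor_complexity_def normalized_complexity_def tuples[symmetric]
      by (rule t.normalized_complexity_eq_card[OF assms(7)[OF that(2)] _ le that(1) fin])
  qed
  have "a \<in> o(\<lambda>n. ln (real n) powr (- 2)) \<longleftrightarrow> lam \<in> o(\<lambda>n. ln (real n) powr (- 2))"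
  proof -
    have "a = (\<lambda>n. inverse (lam 1) * lam n)" by (simp add: a_def[abs_def] divide_inverse mult.commute)
    then show ?thesis using lam1 by simp
  qed
  moreover have "a 2 = 1" if "lam 1 = lam 2" using that lam1 by (simp add: a_def)
  moreover have "a 2 < 1" if "lam 1 > lam 2" using that lam1 by (simp add: a_def)
  ultimately show ?thesis
    using a.curse_if_equal[OF N] a.not_polynomially_tractable[OF N]
      a.weakly_tractable_imp_smallo[OF N] a.smallo_imp_weakly_tractable[OF N] by blast
qed

end
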